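(* Assume the following. (i) There exist functions $b_i:I\times\mathbb R^d\to\mathbb R$ and $\tilde B_i:I\times\mathbb R^d\to\mathbb R^{m^2}$ such that $B_i=b_iI_m+\tilde B_i$ for any $i=1,\dots,d$, a number $\sigma>0$ and a function $\xi:I\to(0,+\infty)$ such that $|(\tilde B_i)_{jk}(t,x)|\le \xi(t)\lambda_Q^{\sigma}(t,x)$ for all $(t,x)\in I\times\mathbb R^d$, $j,k=1,\dots,m$, $i=1,\dots,d$. (ii) For any bounded interval $J\subset I$ there exists $\beta\ge 1/4$ such that $H_{\beta,J}:=\sup_{J\times\mathbb R^d}(\Lambda_C+\beta dm^2\xi^2\lambda_Q^{2\sigma-1})<+\infty$. (iii) For any bounded interval $J\subset I$ there exist $\lambda_J>0$ and a positive function $\varphi_J\in C^2(\mathbb R^d)$, blowing up as $|x|\to+\infty$, such that $\sup_{J\times\mathbb R^d}(\mathcal A\varphi_J-\lambda_J\varphi_J)<+\infty$, where $\mathcal A={\rm div}(QD_x)+\langle b,D_x\rangle$, $b=(b_1,\dots,b_d)$. Then, for every bounded interval $J\subset I$ and every $p\ge 1+\frac1{4\beta}$ (with $\beta$ as in (ii)), there exists a positive constant $K_J$ such that $$|({\bf G}(t,s){\bf f})(x)|^p\le e^{pK_J(t-s)}\,(G(t,s)|{\bf f}|^p)(x)$$ for any $(t,s)\in\Sigma_J$, $x\in\mathbb R^d$ and ${\bf f}\in C_b(\mathbb R^d;\mathbb R^m)$, where $G(t,s)$ denotes the evolution operator in $C_b(\mathbb R^d)$ associated with the operator $\mathcal A$.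 Here, $K_J=H_{1/4,J}$ (the supremum in (ii) with $\beta$ replaced by $1/4$) if $p\ge2$, whereas $K_J=H_{\beta,J}$ if $p\in[1+\frac1{4\beta},2)$.
   Context: Let $d,m\ge1$ be integers, $I\subset\mathbb R$ an open right half-line (possibly $I=\mathbb R$), $\alpha\in(0,1)$. For an interval $J$, $\Sigma_J=\{(t,s)\in J\times J: t>s\}$. $C_b$ denotes bounded continuous functions. Consider $$\boldsymbol{\mathcal A}(t){\bf v}=\sum_{i,j=1}^dD_i(q_{ij}(t,\cdot)D_j{\bf v})+\sum_{i=1}^dB_i(t,\cdot)D_i{\bf v}+C(t,\cdot){\bf v},\qquad {\bf v}:\mathbb R^d\to\mathbb R^m,$$ with $q_{ij}:I\times\mathbb R^d\to\mathbb R$, $B_i,C:I\times\mathbb R^d\to\mathbb R^{m^2}$ ($m\times m$ matrices). Standing assumptions: $Q=[q_{ij}]$, $B_i$ and $C$ are symmetric; $q_{ij}$ and the entries of $B_i$ belong to $C^{\alpha/2,1+\alpha}_{\rm loc}(I\times\mathbb R^d)$ (they and their first-order spatial derivatives are locally in the parabolic Hölder space $C^{\alpha/2,\alpha}$); the entries of $C$ belong to $C^{\alpha/2,\alpha}_{\rm loc}(I\times\mathbb R^d)$; and $\nu_0:=\inf_{I\times\mathbb R^d}\lambda_Q>0$, where $\lambda_Q(t,x)$ is the minimum eigenvalue of $Q(t,x)$. $\Lambda_C(t,x)$ is the maximum eigenvalue of $C(t,x)$. Under the assumptions of the claim it is known that for every $s\in I$ and ${\bf f}\in C_b(\mathbb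 R^d;\mathbb R^m)$ the Cauchy problem $D_t{\bf u}=\boldsymbol{\mathcal A}(t){\bf u}$ in $(s,+\infty)\times\mathbb R^d$, ${\bf u}(s,\cdot)={\bf f}$, has a unique classical solution ${\bf u}$ bounded in every strip $[s,T]\times\mathbb R^d$; one sets ${\bf G}(t,s){\bf f}:={\bf u}(t,\cdot)$. Similarly $G(\cdot,s)f$ is the unique classical solution, bounded in each strip, of the scalar problem $D_tu=\mathcal A(t)u$, $u(s,\cdot)=f\in C_b(\mathbb R^d)$.
   Formalization: The suprema H may be zero or negative (e.g. C = -10 I_m, all B_i = 0, small ξ), so K_J cannot always be both positive and equal to H; proved instead: the estimate holds with K_J = H whatever its sign, and also with some positive constant. *)

theory Defs
  imports "HOL-Analysis.Analysis"
begin

definition partial_deriv ::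
    "'d::finite \<Rightarrow> (real^'d \<Rightarrow> 'b::real_normed_vector) \<Rightarrow> real^'d \<Rightarrow> 'b" where
  "partial_deriv i f x = vector_derivative (\<lambda>h. f (x + h *\<^sub>R axis i 1)) (at 0)"

definition has_partials :: "(real^'d::finite \<Rightarrow> 'b::real_normed_vector) \<Rightarrow> bool" where
  "has_partials f \<longleftrightarrow> (\<forall>i x. (\<lambda>h. f (x + h *\<^sub>R axis i 1)) differentiable (at 0))"

definition C2_fun :: "(real^'d::finite \<Rightarrow> 'b::real_normed_vector) \<Rightarrow> bool" where
  "C2_fun f \<longleftrightarrow>
     continuous_on UNIV f \<and> has_partials f \<and>
     (\<forall>i. continuous_on UNIV (partial_deriv i f) \<and> has_partials (partial_deriv i f) \<and>
       (\<forall>j. continuous_on UNIV (partial_deriv j (partial_deriv i f))))"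

definition C12_on :: "real set \<Rightarrow> (real \<Rightarrow> real^'d::finite \<Rightarrow> 'b::real_normed_vector) \<Rightarrow> bool" where
  "C12_on T u \<longleftrightarrow>
     continuous_on (T \<times> UNIV) (\<lambda>(t, x). u t x) \<and>
     (\<forall>t\<in>T. \<forall>x. (\<lambda>\<tau>. u \<tau> x) differentiable (at t)) \<and>
     continuous_on (T \<times> UNIV) (\<lambda>(t, x). vector_derivative (\<lambda>\<tau>. u \<tau> x) (at t)) \<and>
     (\<forall>t\<in>T. has_partials (u t)) \<and>
     (\<forall>i. continuous_on (T \<times> UNIV) (\<lambda>(t, x). partial_deriv i (u t) x) \<and>
       (\<forall>t\<in>T. has_partials (partial_deriv i (u t))) \<and>
       (\<forall>j. continuous_on (T \<times> UNIV) (\<lambda>(t, x). partial_deriv j (partial_deriv i (u t)) x)))"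

text \<open>Local parabolic Hoelder spaces with exponents \<open>(\<alpha>/2, \<alpha>)\<close> and \<open>(\<alpha>/2, 1 + \<alpha>)\<close>: the Hoelder
  estimate is required on every compact subset of \<open>I \<times> \<real>\<^sup>d\<close>, where it entails boundedness. In the
  second space it is required of the function and of its first-order spatial derivatives.\<close>

definition loc_holder ::
    "real \<Rightarrow> real set \<Rightarrow> (real \<Rightarrow> real^'d::finite \<Rightarrow> real) \<Rightarrow> bool" where
  "loc_holder \<alpha> I f \<longleftrightarrow>
     (\<forall>K. compact K \<and> K \<subseteq> I \<times> UNIV \<longrightarrow>
       (\<exists>M. \<forall>(t, x)\<in>K. \<forall>(s, y)\<in>K.
          \<bar>f t x - f s y\<bar> \<le> M * (\<bar>t - s\<bar> powr (\<alpha> / 2) + norm (x - y) powr \<alpha>)))"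

definition loc_holder1 ::
    "real \<Rightarrow> real set \<Rightarrow> (real \<Rightarrow> real^'d::finite \<Rightarrow> real) \<Rightarrow> bool" where
  "loc_holder1 \<alpha> I f \<longleftrightarrow>
     loc_holder \<alpha> I f \<and> (\<forall>t\<in>I. has_partials (f t)) \<and>
     (\<forall>i. loc_holder \<alpha> I (\<lambda>t. partial_deriv i (f t)))"

text \<open>\<open>Min\<close> and \<open>Max\<close> are meaningful here because the matrices considered are symmetric, so that
  the set of real eigenvalues is finite and nonempty.\<close>

definition eigenvalues :: "real^'n^'n::finite \<Rightarrow> real set" where
  "eigenvalues A = {l. \<exists>v. v \<noteq> 0 \<and> A *v v = l *\<^sub>R v}"

definition min_eigenvalue :: "real^'n^'n::finite \<Rightarrow> real" where
  "min_eigenvalue A = Min (eigenvalues A)"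

definition max_eigenvalue :: "real^'n^'n::finite \<Rightarrow> real" where
  "max_eigenvalue A = Max (eigenvalues A)"

definition div_part ::
    "(real \<Rightarrow> real^'d \<Rightarrow> real^'d^'d::finite) \<Rightarrow> real \<Rightarrow> (real^'d \<Rightarrow> 'b::real_normed_vector)
      \<Rightarrow> real^'d \<Rightarrow> 'b" where
  "div_part q t v x =
     (\<Sum>i\<in>UNIV. \<Sum>j\<in>UNIV. partial_deriv i (\<lambda>y. (q t y $ i $ j) *\<^sub>R partial_deriv j v y) x)"

definition system_op ::
    "(real \<Rightarrow> real^'d \<Rightarrow> real^'d^'d::finite) \<Rightarrow> ('d \<Rightarrow> real \<Rightarrow> real^'d \<Rightarrow> real^'m^'m::finite)
      \<Rightarrow> (real \<Rightarrow> real^'d \<Rightarrow> real^'m^'m) \<Rightarrow> real \<Rightarrow> (real^'d \<Rightarrow> real^'m) \<Rightarrow> real^'d \<Rightarrow> real^'m" where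
  "system_op q B C t v x =
     div_part q t v x + (\<Sum>i\<in>UNIV. B i t x *v partial_deriv i v x) + C t x *v v x"

definition scalar_op ::
    "(real \<Rightarrow> real^'d \<Rightarrow> real^'d^'d::finite) \<Rightarrow> ('d \<Rightarrow> real \<Rightarrow> real^'d \<Rightarrow> real)
      \<Rightarrow> real \<Rightarrow> (real^'d \<Rightarrow> real) \<Rightarrow> real^'d \<Rightarrow> real" where
  "scalar_op q b t v x = div_part q t v x + (\<Sum>i\<in>UNIV. b i t x * partial_deriv i v x)"

definition classical_solution ::
    "(real \<Rightarrow> (real^'d \<Rightarrow> 'b) \<Rightarrow> real^'d \<Rightarrow> 'b) \<Rightarrow> real \<Rightarrow> (real^'d::finite \<Rightarrow> 'b::real_normed_vector)
      \<Rightarrow> (real \<Rightarrow> real^'d \<Rightarrow> 'b) \<Rightarrow> bool" where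
  "classical_solution L s f u \<longleftrightarrow>
     C12_on {s<..} u \<and> continuous_on ({s..} \<times> UNIV) (\<lambda>(t, x). u t x) \<and>
     (\<forall>t>s. \<forall>x. vector_derivative (\<lambda>\<tau>. u \<tau> x) (at t) = L t (u t) x) \<and>
     u s = f"

definition strip_bounded ::
    "real \<Rightarrow> (real \<Rightarrow> real^'d::finite \<Rightarrow> 'b::real_normed_vector) \<Rightarrow> bool" where
  "strip_bounded s u \<longleftrightarrow> (\<forall>T>s. bounded ((\<lambda>(t, x). u t x) ` ({s..T} \<times> UNIV)))"

text \<open>Existence of classical solutions, bounded in each strip, for all initial times and all bounded
  continuous data.\<close>

definition solvable ::
    "(real \<Rightarrow> (real^'d::finite \<Rightarrow> 'b::real_normed_vector) \<Rightarrow> real^'d \<Rightarrow> 'b) \<Rightarrow> real set \<Rightarrow> bool" where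
  "solvable L I \<longleftrightarrow>
     (\<forall>s\<in>I. \<forall>f\<in>bcontfun. \<exists>u. classical_solution L s f u \<and> strip_bounded s u)"

text \<open>Solutions are functions on all of \<open>\<real> \<times> \<real>\<^sup>d\<close> whose values at times before \<open>s\<close> are irrelevant, hence
  the description is of the slice \<open>u t\<close> (with \<open>t \<ge> s\<close>) and not of \<open>u\<close>.\<close>

definition evol_op ::
    "(real \<Rightarrow> (real^'d \<Rightarrow> 'b) \<Rightarrow> real^'d \<Rightarrow> 'b) \<Rightarrow> real \<Rightarrow> real
      \<Rightarrow> (real^'d::finite \<Rightarrow> 'b::real_normed_vector) \<Rightarrow> real^'d \<Rightarrow> 'b" where
  "evol_op L t s f = (THE g. \<exists>u. classical_solution L s f u \<and> strip_bounded s u \<and> g = u t)"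

definition H_fun ::
    "(real \<Rightarrow> real^'d \<Rightarrow> real^'d^'d::finite) \<Rightarrow> (real \<Rightarrow> real^'d \<Rightarrow> real^'m^'m::finite)
      \<Rightarrow> (real \<Rightarrow> real) \<Rightarrow> real \<Rightarrow> real \<Rightarrow> real \<times> (real^'d) \<Rightarrow> real" where
  "H_fun q C \<xi> \<sigma> \<beta> = (\<lambda>(t, x). max_eigenvalue (C t x) +
     \<beta> * real CARD('d) * (real CARD('m))\<^sup>2 * (\<xi> t)\<^sup>2 * min_eigenvalue (q t x) powr (2 * \<sigma> - 1))"

definition H_const ::
    "(real \<Rightarrow> real^'d \<Rightarrow> real^'d^'d::finite) \<Rightarrow> (real \<Rightarrow> real^'d \<Rightarrow> real^'m^'m::finite)
      \<Rightarrow> (real \<Rightarrow> real) \<Rightarrow> real \<Rightarrow> real \<Rightarrow> real set \<Rightarrow> real" where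
  "H_const q C \<xi> \<sigma> \<beta> J = (SUP z\<in>J \<times> UNIV. H_fun q C \<xi> \<sigma> \<beta> z)"

definition H_finite ::
    "(real \<Rightarrow> real^'d \<Rightarrow> real^'d^'d::finite) \<Rightarrow> (real \<Rightarrow> real^'d \<Rightarrow> real^'m^'m::finite)
      \<Rightarrow> (real \<Rightarrow> real) \<Rightarrow> real \<Rightarrow> real \<Rightarrow> real set \<Rightarrow> bool" where
  "H_finite q C \<xi> \<sigma> \<beta> J \<longleftrightarrow> bdd_above (H_fun q C \<xi> \<sigma> \<beta> ` (J \<times> UNIV))"

end

theory Submission
  imports Defs
begin

text \<open>
  Write \<open>A = div (q D) + \<langle>b, D\<rangle>\<close> for the scalar operator. A solution \<open>u\<close> of the system satisfies
  \<open>D\<^sub>t u = A u + \<Sum>\<^sub>i Bt\<^sub>i D\<^sub>i u + C u\<close>, with \<open>A\<close> acting on each component, so that wherever \<open>u \<noteq> 0\<close>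

  \<open>D\<^sub>t |u|\<^sup>p - A |u|\<^sup>p = p |u|\<^bsup>p-2\<^esup> (u \<bullet> (\<Sum>\<^sub>i Bt\<^sub>i D\<^sub>i u + C u) - \<Sum>\<^sub>i\<^sub>j q\<^sub>i\<^sub>j D\<^sub>i u \<bullet> D\<^sub>j u
      - (p - 2) |u|\<^bsup>-2\<^esup> \<Sum>\<^sub>i\<^sub>j q\<^sub>i\<^sub>j (u \<bullet> D\<^sub>i u) (u \<bullet> D\<^sub>j u))\<close>.

  The two sums with \<open>q\<close> dissipate at least \<open>min 1 (p - 1) \<lambda>\<^sub>Q |Du|\<^sup>2\<close>. Young's inequality absorbs
  the coupling through \<open>Bt\<close> into this dissipation, and the cost is bounded by the second summand of \<open>H_fun\<close>; the
  matrix \<open>C\<close> costs its largest eigenvalue. Altogether the bracket is at most \<open>K |u|\<^sup>2\<close>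
  (\<open>dissipation_inequality\<close>), and \<open>|u|\<^sup>p\<close> is a subsolution of \<open>D\<^sub>t w = A w + p K w\<close> off the zeros of \<open>u\<close>.
  The function \<open>exp (p K (t - s)) G(t, s)|f|\<^sup>p\<close> is a solution of the same equation with the same initial value, and it
  is nonnegative. The maximum principle (\<open>maximum_principle\<close>), in which the Lyapunov function compensates for
  the unbounded domain and the unbounded coefficients, then gives the estimate
  (\<open>norm_powr_le_scalar_solution\<close>). It only looks at points where \<open>|u|\<^sup>p\<close> exceeds a nonnegative function, so the
  zeros of \<open>u\<close> never enter.

  The same two comparison results identify the evolution operators with given solutions: the scalar problem is
  monotone in its initial value (\<open>scalar_solution_mono\<close>), and for the system the estimate with \<open>p = 2\<close>
  forces the difference of two solutions with equal initial values to vanish.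

  The definitions speak about partial derivatives. The passage to derivatives in arbitrary directions,
  which second-order conditions at a maximum involve, rests on the differentiability of functions with continuous
  partial derivatives (\<open>has_derivative_continuous_partials\<close>). At a maximum
  the Hessian \<open>H\<close> is negative semidefinite, and \<open>tr (q H) \<le> 0\<close> follows from \<open>trace_psd_nsd_nonpos\<close>.
\<close>

section \<open>Symmetric and semidefinite matrices\<close>

lemma symmetric_inner_commute:
  fixes A :: "real^'n^'n::finite"
  assumes "transpose A = A"
  shows "(A *v x) \<bullet> y = x \<bullet> (A *v y)"
  by (metis assms dot_lmul_matrix transpose_matrix_vector)

text \<open>Eigenvectors to distinct eigenvalues are orthogonal and hence linearly independent. Finiteness is what
  makes \<open>min_eigenvalue\<close> and \<open>max_eigenvalue\<close> bounds for all eigenvalues.\<close>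

lemma finite_eigenvalues:
  fixes A :: "real^'n^'n::finite"
  assumes "transpose A = A"
  shows "finite (eigenvalues A)"
proof -
  obtain v where v: "\<And>l. l \<in> eigenvalues A \<Longrightarrow> v l \<noteq> 0 \<and> A *v v l = l *\<^sub>R v l"
    using bchoice[of "eigenvalues A" "\<lambda>l v. v \<noteq> 0 \<and> A *v v = l *\<^sub>R v"]
    unfolding eigenvalues_def by auto
  have orth: "v l \<bullet> v k = 0" if "l \<in> eigenvalues A" "k \<in> eigenvalues A" "l \<noteq> k" for l k
  proof -
    have "(A *v v l) \<bullet> v k = v l \<bullet> (A *v v k)"
      by (rule symmetric_inner_commute[OF assms])
    then have "(l - k) * (v l \<bullet> v k) = 0"
      using v that by (simp add: algebra_simps)
    with that show ?thesis by simp
  qed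
  have inj: "inj_on v (eigenvalues A)"
    by (rule inj_onI) (metis orth v inner_eq_zero_iff)
  have "pairwise orthogonal (v ` eigenvalues A)"
    using orth by (auto simp: pairwise_def orthogonal_def)
  then have "independent (v ` eigenvalues A)"
    using v by (intro pairwise_orthogonal_independent) auto
  then have "finite (v ` eigenvalues A)" by (rule independent_imp_finite)
  with inj show ?thesis using finite_imageD by blast
qed

text \<open>The maximum of the Rayleigh quotient over the unit sphere is attained and is an eigenvalue: at
  a maximiser \<open>v\<close> with value \<open>l\<close> the nonnegative form \<open>w \<mapsto> l |w|\<^sup>2 - w \<bullet> A w\<close> vanishes,
  so its first variation \<open>l v - A v\<close> vanishes as well.\<close>

lemma rayleigh_eigenvalue:
  fixes A :: "real^'n^'n::finite"
  assumes "transpose A = A"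
  shows "\<exists>l\<in>eigenvalues A. \<forall>w. w \<bullet> (A *v w) \<le> l * (norm w)\<^sup>2"
proof -
  have "sphere 0 1 \<noteq> ({}::(real^'n) set)" by simp
  moreover have "continuous_on (sphere 0 1) (\<lambda>w::real^'n. w \<bullet> (A *v w))"
    by (intro continuous_intros linear_continuous_on linear_linear matrix_vector_mul_bounded_linear)
  ultimately obtain v where v: "v \<in> sphere 0 1"
    and max: "\<And>w. w \<in> sphere 0 1 \<Longrightarrow> w \<bullet> (A *v w) \<le> v \<bullet> (A *v v)"
    using continuous_attains_sup[OF compact_sphere, of 0 1 "\<lambda>w::real^'n. w \<bullet> (A *v w)"] by blast
  define l where "l = v \<bullet> (A *v v)"
  have le: "w \<bullet> (A *v w) \<le> l * (norm w)\<^sup>2" for w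
  proof (cases "w = 0")
    case False
    have "((1 / norm w) *\<^sub>R w) \<bullet> (A *v ((1 / norm w) *\<^sub>R w)) \<le> l"
      unfolding l_def using False by (intro max) simp
    then show ?thesis using False
      by (simp add: matrix_vector_mult_scaleR field_simps power2_eq_square)
  qed simp
  define w where "w = l *\<^sub>R v - A *v v"
  have "w = 0"
  proof (rule ccontr)
    assume "w \<noteq> 0"
    define P where "P = l * (norm w)\<^sup>2 - w \<bullet> (A *v w)"
    have nv: "v \<bullet> v = 1" using v by (simp add: norm_eq_1)
    have key: "0 \<le> 2 * t * (w \<bullet> w) + t\<^sup>2 * P" for t
    proof -
      have "v \<bullet> (A *v w) = (A *v v) \<bullet> w"
        by (rule symmetric_inner_commute[OF assms, symmetric])
      then have "l * (norm (v + t *\<^sub>R w))\<^sup>2 - (v + t *\<^sub>R w) \<bullet> (A *v (v + t *\<^sub>R w))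
        = 2 * t * ((l *\<^sub>R v - A *v v) \<bullet> w) + t\<^sup>2 * P"
        unfolding P_def power2_norm_eq_inner
        by (simp add: matrix_vector_right_distrib matrix_vector_mult_scaleR inner_simps
            algebra_simps power2_eq_square nv l_def[symmetric])
           (simp add: inner_commute algebra_simps)
      with le[of "v + t *\<^sub>R w"] show ?thesis by (simp add: w_def)
    qed
    have ww: "w \<bullet> w > 0" using \<open>w \<noteq> 0\<close> by simp
    \<comment> \<open>A negative \<open>t\<close> so close to zero that the linear part of \<open>key\<close> dominates the quadratic one.\<close>
    define t where "t = - (w \<bullet> w) / (\<bar>P\<bar> + 1)"
    have "t < 0" using ww by (simp add: t_def divide_neg_pos)
    have "- (t * P) \<le> \<bar>t\<bar> * \<bar>P\<bar>" by (metis abs_ge_minus_self abs_mult)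
    also have "\<dots> \<le> w \<bullet> w" using ww by (simp add: t_def field_simps abs_mult)
    finally have "2 * (w \<bullet> w) + t * P > 0" using ww by linarith
    then have "t * (2 * (w \<bullet> w) + t * P) < 0" using \<open>t < 0\<close> by (rule mult_neg_pos[rotated])
    with key[of t] show False by (simp add: algebra_simps power2_eq_square)
  qed
  then have "l \<in> eigenvalues A"
    using v unfolding eigenvalues_def w_def by (intro CollectI exI[of _ v]) auto
  with le show ?thesis by blast
qed

lemma quadratic_form_le_max_eigenvalue:
  fixes A :: "real^'n^'n::finite"
  assumes "transpose A = A"
  shows "w \<bullet> (A *v w) \<le> max_eigenvalue A * (norm w)\<^sup>2"
proof -
  obtain l where l: "l \<in> eigenvalues A" "w \<bullet> (A *v w) \<le> l * (norm w)\<^sup>2"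
    using rayleigh_eigenvalue[OF assms] by blast
  have "l \<le> max_eigenvalue A"
    unfolding max_eigenvalue_def using finite_eigenvalues[OF assms] l(1) by simp
  then have "l * (norm w)\<^sup>2 \<le> max_eigenvalue A * (norm w)\<^sup>2" by (intro mult_right_mono) auto
  with l(2) show ?thesis by linarith
qed

lemma matrix_vector_mult_minus_left: "(- A) *v (x::real^'n) = - (A *v x)"
  by (simp add: matrix_vector_mult_def vec_eq_iff sum_negf)

lemma quadratic_form_ge_min_eigenvalue:
  fixes A :: "real^'n^'n::finite"
  assumes "transpose A = A"
  shows "w \<bullet> (A *v w) \<ge> min_eigenvalue A * (norm w)\<^sup>2"
proof -
  have "transpose (- A) = - A" using assms by (simp add: transpose_def vec_eq_iff)
  from rayleigh_eigenvalue[OF this] obtain l where l: "l \<in> eigenvalues (- A)"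
    "w \<bullet> (- A *v w) \<le> l * (norm w)\<^sup>2" by blast
  from l(1) obtain v where "v \<noteq> 0" "A *v v = (- l) *\<^sub>R v"
    unfolding eigenvalues_def matrix_vector_mult_minus_left
    by (auto simp: minus_equation_iff[of "A *v _"])
  then have "- l \<in> eigenvalues A" unfolding eigenvalues_def by blast
  then have "min_eigenvalue A \<le> - l"
    unfolding min_eigenvalue_def using finite_eigenvalues[OF assms] by simp
  then have "min_eigenvalue A * (norm w)\<^sup>2 \<le> (- l) * (norm w)\<^sup>2" by (intro mult_right_mono) auto
  with l(2) show ?thesis by (simp add: matrix_vector_mult_minus_left)
qed

text \<open>The induction splits off the rank-one matrix \<open>Q\<^sub>k Q\<^sub>k\<^sup>T / Q\<^sub>k\<^sub>k\<close>; the remainder is the Schur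
  complement, which is again positive semidefinite and lives on fewer indices. If \<open>Q\<^sub>k\<^sub>k = 0\<close>, the
  whole row \<open>Q\<^sub>k\<close> vanishes and division by zero makes the same formulas valid.\<close>

lemma trace_psd_nsd_nonpos:
  fixes Q H :: "'i \<Rightarrow> 'i \<Rightarrow> real"
  assumes "finite S"
    and "\<And>i j. Q i j = Q j i"
    and "\<And>z. 0 \<le> (\<Sum>i\<in>S. \<Sum>j\<in>S. z i * z j * Q i j)"
    and "\<And>z. (\<Sum>i\<in>S. \<Sum>j\<in>S. z i * z j * H i j) \<le> 0"
  shows "(\<Sum>i\<in>S. \<Sum>j\<in>S. Q i j * H i j) \<le> 0"
  using assms
proof (induction S arbitrary: Q)
  case (insert k S)
  note sym = insert.prems(1)
  have split: "(\<Sum>i\<in>insert k S. \<Sum>j\<in>insert k S. F i j)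
      = F k k + (\<Sum>j\<in>S. F k j) + (\<Sum>i\<in>S. F i k) + (\<Sum>i\<in>S. \<Sum>j\<in>S. F i j)" for F :: "'i \<Rightarrow> 'i \<Rightarrow> real"
    using insert.hyps by (simp add: sum.distrib)
  have psd: "0 \<le> (\<alpha>::real)\<^sup>2 * Q k k + 2 * \<alpha> * (\<Sum>j\<in>S. z j * Q k j) + (\<Sum>i\<in>S. \<Sum>j\<in>S. z i * z j * Q i j)"
    for \<alpha> z
  proof -
    let ?z = "\<lambda>i. if i = k then \<alpha> else z i"
    have z: "?z i = z i" if "i \<in> S" for i using that insert.hyps by auto
    have "(\<Sum>i\<in>insert k S. \<Sum>j\<in>insert k S. ?z i * ?z j * Q i j)
      = \<alpha> * \<alpha> * Q k k + (\<Sum>j\<in>S. \<alpha> * z j * Q k j) + (\<Sum>i\<in>S. z i * \<alpha> * Q i k)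
        + (\<Sum>i\<in>S. \<Sum>j\<in>S. z i * z j * Q i j)"
      unfolding split using z by (simp cong: sum.cong)
    also have "\<dots> = \<alpha>\<^sup>2 * Q k k + 2 * \<alpha> * (\<Sum>j\<in>S. z j * Q k j) + (\<Sum>i\<in>S. \<Sum>j\<in>S. z i * z j * Q i j)"
    proof -
      have "(\<Sum>j\<in>S. \<alpha> * z j * Q k j) = \<alpha> * (\<Sum>j\<in>S. z j * Q k j)"
        by (simp add: sum_distrib_left mult.assoc)
      moreover have "(\<Sum>i\<in>S. z i * \<alpha> * Q i k) = \<alpha> * (\<Sum>j\<in>S. z j * Q k j)"
        unfolding sum_distrib_left using sym by (intro sum.cong) (auto simp: mult.commute)
      ultimately show ?thesis by (simp add: power2_eq_square)
    qed
    finally show ?thesis using insert.prems(2)[of ?z] by simp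
  qed
  have "0 \<le> Q k k" using psd[of 1 "\<lambda>_. 0"] by simp
  have row: "Q k j = 0" if "Q k k = 0" "j \<in> S" for j
  proof (rule ccontr)
    assume "Q k j \<noteq> 0"
    have delta: "(\<Sum>l\<in>S. (if l = j then 1 else 0) * F l) = F j" for F :: "'i \<Rightarrow> real"
      using that insert.hyps by (simp add: if_distrib[of "\<lambda>x. x * _"] cong: if_cong)
    have "0 \<le> 2 * \<alpha> * Q k j + Q j j" for \<alpha>
      using psd[of \<alpha> "\<lambda>l. if l = j then 1 else 0"] that
      by (simp add: delta mult.assoc flip: sum_distrib_left)
    \<comment> \<open>An affine function of \<open>\<alpha>\<close> with nonzero slope takes the value \<open>-1\<close>.\<close>
    from this[of "- (Q j j + 1) / (2 * Q k j)"] \<open>Q k j \<noteq> 0\<close> show False by (simp add: field_simps)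
  qed
  define Q' where "Q' i j = Q i j - Q k i * Q k j / Q k k" for i j
  have psd': "0 \<le> (\<Sum>i\<in>S. \<Sum>j\<in>S. z i * z j * Q' i j)" for z
  proof -
    define m where "m = (\<Sum>j\<in>S. z j * Q k j)"
    have "(\<Sum>i\<in>S. \<Sum>j\<in>S. z i * z j * Q' i j)
        = (\<Sum>i\<in>S. \<Sum>j\<in>S. z i * z j * Q i j) - (\<Sum>i\<in>S. \<Sum>j\<in>S. (z i * Q k i) * (z j * Q k j)) / Q k k"
      by (simp add: Q'_def sum_divide_distrib algebra_simps flip: sum_subtractf)
    also have "(\<Sum>i\<in>S. \<Sum>j\<in>S. (z i * Q k i) * (z j * Q k j)) = m\<^sup>2"
      by (simp add: m_def sum_product power2_eq_square)
    also have "(\<Sum>i\<in>S. \<Sum>j\<in>S. z i * z j * Q i j) - m\<^sup>2 / Q k k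
        = (- m / Q k k)\<^sup>2 * Q k k + 2 * (- m / Q k k) * (\<Sum>j\<in>S. z j * Q k j)
          + (\<Sum>i\<in>S. \<Sum>j\<in>S. z i * z j * Q i j)"
      by (simp add: m_def[symmetric] power2_eq_square)
    \<comment> \<open>The coordinate \<open>\<alpha> = - m / Q k k\<close> minimises the full form over the \<open>k\<close>-th direction.\<close>
    finally show ?thesis using psd[of "- m / Q k k" z] by simp
  qed
  have nsd': "(\<Sum>i\<in>S. \<Sum>j\<in>S. z i * z j * H i j) \<le> 0" for z
  proof -
    have "(\<Sum>i\<in>S. \<Sum>j\<in>S. z i * z j * H i j)
      = (\<Sum>i\<in>insert k S. \<Sum>j\<in>insert k S.
          (if i = k then 0 else z i) * (if j = k then 0 else z j) * H i j)"
      unfolding split using insert.hyps by (auto intro!: sum.cong)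
    also have "\<dots> \<le> 0" by (rule insert.prems(3))
    finally show ?thesis .
  qed
  have "(\<Sum>i\<in>S. \<Sum>j\<in>S. Q' i j * H i j) \<le> 0"
  proof (rule insert.IH)
    show "Q' i j = Q' j i" for i j unfolding Q'_def sym[of i j] by (simp add: mult.commute)
  qed (fact psd' nsd')+
  moreover have "(\<Sum>i\<in>insert k S. \<Sum>j\<in>insert k S. Q k i * Q k j * H i j) / Q k k \<le> 0"
    using insert.prems(3)[of "Q k"] \<open>0 \<le> Q k k\<close> by (rule divide_nonpos_nonneg)
  moreover have "(\<Sum>i\<in>insert k S. \<Sum>j\<in>insert k S. Q i j * H i j)
      = (\<Sum>i\<in>S. \<Sum>j\<in>S. Q' i j * H i j)
        + (\<Sum>i\<in>insert k S. \<Sum>j\<in>insert k S. Q k i * Q k j * H i j) / Q k k"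
  proof -
    have entry: "Q k i * Q k j * x / Q k k = Q i j * x" if "i = k \<or> j = k" "i \<in> insert k S" "j \<in> insert k S"
      for i j x
      using that row by (cases "Q k k = 0") (auto simp: sym)
    have S: "(\<Sum>i\<in>S. \<Sum>j\<in>S. Q' i j * H i j)
      = (\<Sum>i\<in>S. \<Sum>j\<in>S. Q i j * H i j) - (\<Sum>i\<in>S. \<Sum>j\<in>S. Q k i * Q k j * H i j / Q k k)"
      by (simp add: Q'_def algebra_simps flip: sum_subtractf)
    show ?thesis
      unfolding S split sum_divide_distrib add_divide_distrib using entry by simp
  qed
  ultimately show ?case by linarith
qed simp

section \<open>Differentiability from continuous partial derivatives\<close>

text \<open>The induction changes one coordinate at a time: along the \<open>k\<close>-th axis the mean value
  inequality applies, with the continuity of the \<open>k\<close>-th partial derivative controlling the error.\<close>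

lemma has_derivative_continuous_partials:
  fixes f :: "real^'d::finite \<Rightarrow> 'b::real_normed_vector"
  assumes "has_partials f" and cont: "\<And>i. continuous_on UNIV (partial_deriv i f)"
  shows "(f has_derivative (\<lambda>v. \<Sum>i\<in>UNIV. (v $ i) *\<^sub>R partial_deriv i f x)) (at x)"
proof -
  have line: "((\<lambda>h. f (y + h *\<^sub>R axis i 1)) has_vector_derivative partial_deriv i f (y + h *\<^sub>R axis i 1)) (at h)"
    for y i h
  proof -
    have "((\<lambda>k. f (y + h *\<^sub>R axis i 1 + k *\<^sub>R axis i 1)) has_vector_derivative
        partial_deriv i f (y + h *\<^sub>R axis i 1)) (at 0)"
      unfolding partial_deriv_def
      using assms(1) by (simp add: has_partials_def flip: vector_derivative_works)
    then have "((\<lambda>k. f (y + h *\<^sub>R axis i 1 + k *\<^sub>R axis i 1)) \<circ> (\<lambda>k. k - h) has_vector_derivative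
        1 *\<^sub>R partial_deriv i f (y + h *\<^sub>R axis i 1)) (at h)"
      by (intro vector_diff_chain_at) (auto intro!: derivative_eq_intros)
    then show ?thesis by (simp add: o_def algebra_simps)
  qed
  have approx: "\<exists>d>0. \<forall>v. (\<forall>i. i \<notin> S \<longrightarrow> v $ i = 0) \<and> norm v < d \<longrightarrow>
      norm (f (x + v) - f x - (\<Sum>i\<in>S. (v $ i) *\<^sub>R partial_deriv i f x)) \<le> e * (\<Sum>i\<in>S. \<bar>v $ i\<bar>)"
    if "e > 0" "finite S" for e S
    using \<open>finite S\<close>
  proof induction
    case empty
    have "v = 0" if "\<forall>i. v $ i = 0" for v :: "real^'d" using that by (simp add: vec_eq_iff)
    then show ?case by (intro exI[of _ 1]) fastforce
  next
    case (insert k S)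
    obtain d1 where d1: "d1 > 0" "\<And>v. \<forall>i. i \<notin> S \<longrightarrow> v $ i = 0 \<Longrightarrow> norm v < d1 \<Longrightarrow>
        norm (f (x + v) - f x - (\<Sum>i\<in>S. (v $ i) *\<^sub>R partial_deriv i f x)) \<le> e * (\<Sum>i\<in>S. \<bar>v $ i\<bar>)"
      using insert.IH by blast
    obtain d2 where d2: "d2 > 0"
      "\<And>y. dist y x < d2 \<Longrightarrow> dist (partial_deriv k f y) (partial_deriv k f x) \<le> e / 3"
      using cont[of k, unfolded continuous_on_iff, rule_format, of x "e/3"] \<open>e > 0\<close>
      by (auto intro: less_imp_le)
    show ?case
    proof (intro exI[of _ "min d1 (d2/2)"] conjI allI impI)
      show "min d1 (d2 / 2) > 0" using d1 d2 by simp
      fix v :: "real^'d" assume v: "(\<forall>i. i \<notin> insert k S \<longrightarrow> v $ i = 0) \<and> norm v < min d1 (d2 / 2)"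
      define w where "w = v - (v $ k) *\<^sub>R axis k 1"
      have wS: "w $ i = v $ i" if "i \<noteq> k" for i using that by (simp add: w_def axis_def)
      have wk: "w $ k = 0" by (simp add: w_def axis_def)
      have nw: "norm w \<le> norm v" by (rule norm_le_componentwise_cart) (metis wS wk norm_ge_zero norm_zero order.refl)
      have 1: "norm (f (x + w) - f x - (\<Sum>i\<in>S. (v $ i) *\<^sub>R partial_deriv i f x)) \<le> e * (\<Sum>i\<in>S. \<bar>v $ i\<bar>)"
      proof -
        have "norm (f (x + w) - f x - (\<Sum>i\<in>S. (w $ i) *\<^sub>R partial_deriv i f x)) \<le> e * (\<Sum>i\<in>S. \<bar>w $ i\<bar>)"
          using v nw wS wk insert.hyps by (intro d1(2)) (metis insertE, linarith)
        moreover have "w $ i = v $ i" if "i \<in> S" for i using wS that insert.hyps by metis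
        ultimately show ?thesis by simp
      qed
      let ?g = "\<lambda>h. f (x + w + h *\<^sub>R axis k 1)"
      have near: "dist (x + w + h *\<^sub>R axis k 1) x < d2" if "h \<in> closed_segment 0 (v $ k)" for h
      proof -
        have "\<bar>h\<bar> \<le> \<bar>v $ k\<bar>" using that by (auto simp: closed_segment_eq_real_ivl split: if_splits)
        have "norm (w + h *\<^sub>R axis k 1) \<le> norm w + \<bar>h\<bar>"
          using norm_triangle_ineq[of w "h *\<^sub>R axis k 1"] by simp
        also have "\<dots> \<le> norm v + norm v"
          using nw \<open>\<bar>h\<bar> \<le> \<bar>v $ k\<bar>\<close> component_le_norm_cart[of v k] by linarith
        also have "\<dots> < d2" using v by linarith
        finally show ?thesis by (simp add: dist_norm add.assoc)
      qed
      have "norm (?g (v $ k) - ?g 0 - (v $ k - 0) *\<^sub>R partial_deriv k f (x + w + 0 *\<^sub>R axis k 1))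
          \<le> norm (v $ k - 0) * (2 * e / 3)"
      proof (rule vector_differentiable_bound_linearization[where S = "closed_segment 0 (v $ k)"
            and f' = "\<lambda>h. partial_deriv k f (x + w + h *\<^sub>R axis k 1)" and ?x0.0 = 0])
        show "(?g has_vector_derivative partial_deriv k f (x + w + h *\<^sub>R axis k 1))
            (at h within closed_segment 0 (v $ k))" if "h \<in> closed_segment 0 (v $ k)" for h
          using line[of "x + w" k h] by (rule has_vector_derivative_at_within)
        show "norm (partial_deriv k f (x + w + h *\<^sub>R axis k 1) - partial_deriv k f (x + w + 0 *\<^sub>R axis k 1))
            \<le> 2 * e / 3" if "h \<in> closed_segment 0 (v $ k)" for h
        proof -
          have "dist (partial_deriv k f (x + w + h *\<^sub>R axis k 1)) (partial_deriv k f x) \<le> e / 3"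
            by (rule d2(2)[OF near[OF that]])
          moreover have "dist (partial_deriv k f (x + w + 0 *\<^sub>R axis k 1)) (partial_deriv k f x) \<le> e / 3"
            by (rule d2(2)[OF near]) simp
          ultimately show ?thesis using dist_triangle2[of "partial_deriv k f (x + w + h *\<^sub>R axis k 1)"
              "partial_deriv k f (x + w + 0 *\<^sub>R axis k 1)" "partial_deriv k f x"]
            by (simp add: dist_norm)
        qed
      qed auto
      moreover have "x + w + (v $ k) *\<^sub>R axis k 1 = x + v" by (simp add: w_def)
      ultimately have 2: "norm (f (x + v) - f (x + w) - (v $ k) *\<^sub>R partial_deriv k f (x + w))
          \<le> \<bar>v $ k\<bar> * (2 * e / 3)" by simp
      have "dist (partial_deriv k f (x + w)) (partial_deriv k f x) \<le> e / 3"
        using d2(2)[of "x + w"] near[of 0] by simp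
      then have "\<bar>v $ k\<bar> * norm (partial_deriv k f (x + w) - partial_deriv k f x) \<le> \<bar>v $ k\<bar> * (e / 3)"
        by (intro mult_left_mono) (auto simp: dist_norm)
      then have 3: "norm ((v $ k) *\<^sub>R partial_deriv k f (x + w) - (v $ k) *\<^sub>R partial_deriv k f x)
          \<le> \<bar>v $ k\<bar> * (e / 3)" by (simp flip: scaleR_diff_right)
      have "f (x + v) - f x - (\<Sum>i\<in>insert k S. (v $ i) *\<^sub>R partial_deriv i f x)
        = (f (x + w) - f x - (\<Sum>i\<in>S. (v $ i) *\<^sub>R partial_deriv i f x))
          + (f (x + v) - f (x + w) - (v $ k) *\<^sub>R partial_deriv k f (x + w))
          + ((v $ k) *\<^sub>R partial_deriv k f (x + w) - (v $ k) *\<^sub>R partial_deriv k f x)"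
        using insert.hyps by simp
      also have "norm \<dots> \<le> e * (\<Sum>i\<in>S. \<bar>v $ i\<bar>) + \<bar>v $ k\<bar> * (2 * e / 3) + \<bar>v $ k\<bar> * (e / 3)"
        by (intro norm_triangle_mono 1 2 3)
      also have "\<dots> = e * (\<Sum>i\<in>insert k S. \<bar>v $ i\<bar>)"
        using insert.hyps by (simp add: field_simps)
      finally show "norm (f (x + v) - f x - (\<Sum>i\<in>insert k S. (v $ i) *\<^sub>R partial_deriv i f x))
          \<le> e * (\<Sum>i\<in>insert k S. \<bar>v $ i\<bar>)" .
    qed
  qed
  show ?thesis
    unfolding has_derivative_at_alt
  proof (intro conjI allI impI)
    show "bounded_linear (\<lambda>v. \<Sum>i\<in>UNIV. (v $ i) *\<^sub>R partial_deriv i f x)"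
      by (intro bounded_linear_sum bounded_linear_scaleR_const bounded_linear_vec_nth)
    fix e :: real assume "e > 0"
    define c where "c = e / CARD('d)"
    have "c > 0" using \<open>e > 0\<close> by (simp add: c_def)
    from approx[OF this finite] obtain d where d: "d > 0" "\<And>v. norm v < d \<Longrightarrow>
        norm (f (x + v) - f x - (\<Sum>i\<in>UNIV. (v $ i) *\<^sub>R partial_deriv i f x)) \<le> c * (\<Sum>i\<in>UNIV. \<bar>v $ i\<bar>)"
      by (metis UNIV_I)
    have "c * (\<Sum>i\<in>UNIV. \<bar>v $ i\<bar>) \<le> e * norm v" for v :: "real^'d"
    proof -
      have "(\<Sum>i\<in>UNIV. \<bar>v $ i\<bar>) \<le> (\<Sum>i\<in>(UNIV::'d set). norm v)"
        by (intro sum_mono component_le_norm_cart)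
      then have "c * (\<Sum>i\<in>UNIV. \<bar>v $ i\<bar>) \<le> c * (CARD('d) * norm v)"
        using \<open>c > 0\<close> by (intro mult_left_mono) auto
      then show ?thesis by (simp add: c_def)
    qed
    then have "norm (f (x + v) - f x - (\<Sum>i\<in>UNIV. (v $ i) *\<^sub>R partial_deriv i f x)) \<le> e * norm v"
      if "norm v < d" for v
      using d(2)[OF that] by (rule order_trans[rotated])
    from this[of "_ - x"] \<open>d > 0\<close> show "\<exists>d>0. \<forall>y. norm (y - x) < d \<longrightarrow>
        norm (f y - f x - (\<Sum>i\<in>UNIV. ((y - x) $ i) *\<^sub>R partial_deriv i f x)) \<le> e * norm (y - x)"
      by auto
  qed
qed

section \<open>Second-order conditions along lines\<close>

text \<open>Gradient \<open>g\<close> and Hessian \<open>H\<close> of \<open>f\<close> at \<open>x\<close>, recorded only through the first two derivatives of the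
  restrictions of \<open>f\<close> to lines through \<open>x\<close>. This is all that a maximum reveals, it reduces the chain rule for
  \<open>|u|\<^sup>p\<close> to one variable, and it asks for regularity near \<open>x\<close> only.\<close>

definition line_jet ::
    "(real^'d::finite \<Rightarrow> real) \<Rightarrow> real^'d \<Rightarrow> ('d \<Rightarrow> real) \<Rightarrow> ('d \<Rightarrow> 'd \<Rightarrow> real) \<Rightarrow> bool" where
  "line_jet f x g H \<longleftrightarrow>
     (\<forall>v. \<exists>F'. (\<forall>\<^sub>F h in nhds 0. ((\<lambda>k. f (x + k *\<^sub>R v)) has_real_derivative F' h) (at h)) \<and>
       F' 0 = (\<Sum>i\<in>UNIV. v $ i * g i) \<and>
       (F' has_real_derivative (\<Sum>i\<in>UNIV. \<Sum>j\<in>UNIV. v $ i * v $ j * H i j)) (at 0))"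

lemma line_jet_linear_combination:
  assumes "line_jet f x g H" "line_jet f' x g' H'"
  shows "line_jet (\<lambda>y. a * f y - b * f' y + c) x (\<lambda>i. a * g i - b * g' i)
    (\<lambda>i j. a * H i j - b * H' i j)"
  unfolding line_jet_def
proof
  fix v
  obtain F where F: "\<forall>\<^sub>F h in nhds 0. ((\<lambda>k. f (x + k *\<^sub>R v)) has_real_derivative F h) (at h)"
    "F 0 = (\<Sum>i\<in>UNIV. v $ i * g i)"
    "(F has_real_derivative (\<Sum>i\<in>UNIV. \<Sum>j\<in>UNIV. v $ i * v $ j * H i j)) (at 0)"
    using assms(1) unfolding line_jet_def by blast
  obtain F' where F': "\<forall>\<^sub>F h in nhds 0. ((\<lambda>k. f' (x + k *\<^sub>R v)) has_real_derivative F' h) (at h)"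
    "F' 0 = (\<Sum>i\<in>UNIV. v $ i * g' i)"
    "(F' has_real_derivative (\<Sum>i\<in>UNIV. \<Sum>j\<in>UNIV. v $ i * v $ j * H' i j)) (at 0)"
    using assms(2) unfolding line_jet_def by blast
  show "\<exists>F'. (\<forall>\<^sub>F h in nhds 0.
            ((\<lambda>k. a * f (x + k *\<^sub>R v) - b * f' (x + k *\<^sub>R v) + c) has_real_derivative F' h) (at h)) \<and>
       F' 0 = (\<Sum>i\<in>UNIV. v $ i * (a * g i - b * g' i)) \<and>
       (F' has_real_derivative
          (\<Sum>i\<in>UNIV. \<Sum>j\<in>UNIV. v $ i * v $ j * (a * H i j - b * H' i j))) (at 0)"
  proof (intro exI[of _ "\<lambda>h. a * F h - b * F' h"] conjI)
    show "\<forall>\<^sub>F h in nhds 0. ((\<lambda>k. a * f (x + k *\<^sub>R v) - b * f' (x + k *\<^sub>R v) + c)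
        has_real_derivative a * F h - b * F' h) (at h)"
      using F(1) F'(1) by eventually_elim (auto intro!: derivative_eq_intros)
    show "a * F 0 - b * F' 0 = (\<Sum>i\<in>UNIV. v $ i * (a * g i - b * g' i))"
      unfolding F(2) F'(2)
      by (simp add: sum_distrib_left sum_subtractf[symmetric] algebra_simps)
    show "((\<lambda>h. a * F h - b * F' h) has_real_derivative
        (\<Sum>i\<in>UNIV. \<Sum>j\<in>UNIV. v $ i * v $ j * (a * H i j - b * H' i j))) (at 0)"
      using F(3) F'(3)
      by (auto intro!: derivative_eq_intros
          simp: sum_distrib_left sum_subtractf[symmetric] algebra_simps)
  qed
qed

text \<open>If \<open>D > 0\<close>, then \<open>F'\<close>, which vanishes at the maximum, would be positive immediately to the right, and
  \<open>F\<close> would increase there.\<close>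

lemma second_derivative_nonpos_at_max:
  fixes F :: "real \<Rightarrow> real"
  assumes "\<forall>\<^sub>F h in nhds 0. (F has_real_derivative F' h) (at h)"
    and F'': "(F' has_real_derivative D) (at 0)"
    and max: "\<And>h. F h \<le> F 0"
  shows "F' 0 = 0" and "D \<le> 0"
proof -
  obtain e where e: "e > 0" "\<And>h. \<bar>h\<bar> < e \<Longrightarrow> (F has_real_derivative F' h) (at h)"
    using assms(1) by (auto simp: eventually_nhds_metric dist_real_def)
  show zero: "F' 0 = 0"
    by (rule DERIV_local_max[of F _ 0 1]) (use e max in auto)
  show "D \<le> 0"
  proof (rule ccontr)
    assume "\<not> D \<le> 0"
    then obtain d where d: "d > 0" "\<And>h. 0 < h \<Longrightarrow> h < d \<Longrightarrow> F' h > 0"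
      using DERIV_pos_inc_right[OF F''] zero by auto
    define r where "r = min d e / 2"
    have r: "0 < r" "r < d" "r < e" using d(1) e(1) by (auto simp: r_def)
    have "F 0 < F r"
    proof (rule DERIV_pos_imp_increasing_open[OF r(1)])
      show "\<exists>y. (F has_real_derivative y) (at h) \<and> y > 0" if "0 < h" "h < r" for h
        using d(2)[of h] e(2)[of h] that r by auto
      have "isCont F h" if "h \<in> {0..r}" for h
        using e(2)[of h] that r DERIV_isCont by fastforce
      then show "continuous_on {0..r} F" using continuous_at_imp_continuous_on by blast
    qed
    with max[of r] show False by simp
  qed
qed

lemma line_jet_at_max:
  assumes "line_jet f x g H" and max: "\<And>y. f y \<le> f x"
  shows "g i = 0" and "(\<Sum>i\<in>UNIV. \<Sum>j\<in>UNIV. z i * z j * H i j) \<le> 0"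
proof -
  have *: "(\<Sum>i\<in>UNIV. v $ i * g i) = 0 \<and> (\<Sum>i\<in>UNIV. \<Sum>j\<in>UNIV. v $ i * v $ j * H i j) \<le> 0" for v
  proof -
    obtain F' where F': "\<forall>\<^sub>F h in nhds 0. ((\<lambda>k. f (x + k *\<^sub>R v)) has_real_derivative F' h) (at h)"
      "F' 0 = (\<Sum>i\<in>UNIV. v $ i * g i)"
      "(F' has_real_derivative (\<Sum>i\<in>UNIV. \<Sum>j\<in>UNIV. v $ i * v $ j * H i j)) (at 0)"
      using assms(1) unfolding line_jet_def by blast
    show ?thesis
      using second_derivative_nonpos_at_max[OF F'(1) F'(3)] max F'(2) by simp
  qed
  show "g i = 0" using *[of "axis i 1"]
    by (simp add: axis_def if_distrib[of "\<lambda>x. x * _"] cong: if_cong)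
  show "(\<Sum>i\<in>UNIV. \<Sum>j\<in>UNIV. z i * z j * H i j) \<le> 0" using *[of "\<chi> i. z i"] by simp
qed

section \<open>Derivatives of twice differentiable functions along lines\<close>

text \<open>Global first and second derivatives with an explicit choice of the derivative functions. Unlike the
  operators \<open>partial_deriv\<close>, this form is visibly linear, which gives differences of solutions for free.\<close>

definition jet2 ::
    "(real^'d::finite \<Rightarrow> 'b::real_normed_vector) \<Rightarrow> ('d \<Rightarrow> real^'d \<Rightarrow> 'b)
      \<Rightarrow> ('d \<Rightarrow> 'd \<Rightarrow> real^'d \<Rightarrow> 'b) \<Rightarrow> bool" where
  "jet2 f f1 f2 \<longleftrightarrow>
     (\<forall>x. (f has_derivative (\<lambda>v. \<Sum>i\<in>UNIV. (v $ i) *\<^sub>R f1 i x)) (at x)) \<and>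
     (\<forall>i x. (f1 i has_derivative (\<lambda>v. \<Sum>j\<in>UNIV. (v $ j) *\<^sub>R f2 i j x)) (at x))"

lemma C2_fun_jet2:
  assumes "C2_fun f"
  shows "jet2 f (\<lambda>i. partial_deriv i f) (\<lambda>i j. partial_deriv j (partial_deriv i f))"
  using assms unfolding jet2_def C2_fun_def by (blast intro: has_derivative_continuous_partials)

lemma jet2_diff:
  assumes "jet2 f f1 f2" "jet2 g g1 g2"
  shows "jet2 (\<lambda>x. f x - g x) (\<lambda>i x. f1 i x - g1 i x) (\<lambda>i j x. f2 i j x - g2 i j x)"
  using assms unfolding jet2_def
  by (simp add: scaleR_diff_right sum_subtractf has_derivative_diff)

lemma jet2_along_line:
  assumes "jet2 f f1 f2"
  shows "((\<lambda>h. f (x + h *\<^sub>R v)) has_vector_derivative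
      (\<Sum>i\<in>UNIV. (v $ i) *\<^sub>R f1 i (x + h *\<^sub>R v))) (at h)"
    and "((\<lambda>h. \<Sum>i\<in>UNIV. (v $ i) *\<^sub>R f1 i (x + h *\<^sub>R v)) has_vector_derivative
      (\<Sum>i\<in>UNIV. \<Sum>j\<in>UNIV. (v $ i * v $ j) *\<^sub>R f2 i j (x + h *\<^sub>R v))) (at h)"
proof -
  have line: "((\<lambda>h. F (x + h *\<^sub>R v)) has_vector_derivative
      (\<Sum>i\<in>UNIV. (v $ i) *\<^sub>R F' i (x + h *\<^sub>R v))) (at h)"
    if "\<And>y. (F has_derivative (\<lambda>v. \<Sum>i\<in>UNIV. (v $ i) *\<^sub>R F' i y)) (at y)"
    for F :: "real^'a \<Rightarrow> 'b" and F'
  proof -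
    have "((\<lambda>h. x + h *\<^sub>R v) has_derivative (\<lambda>k. k *\<^sub>R v)) (at h)"
      by (auto intro!: derivative_eq_intros)
    from has_derivative_compose[OF this that]
    show ?thesis by (simp add: has_vector_derivative_def scaleR_sum_right)
  qed
  show "((\<lambda>h. f (x + h *\<^sub>R v)) has_vector_derivative
      (\<Sum>i\<in>UNIV. (v $ i) *\<^sub>R f1 i (x + h *\<^sub>R v))) (at h)"
    using assms unfolding jet2_def by (intro line) auto
  have "((\<lambda>h. f1 i (x + h *\<^sub>R v)) has_vector_derivative
      (\<Sum>j\<in>UNIV. (v $ j) *\<^sub>R f2 i j (x + h *\<^sub>R v))) (at h)" for i
    using assms unfolding jet2_def by (intro line) auto
  then have "((\<lambda>h. (v $ i) *\<^sub>R f1 i (x + h *\<^sub>R v)) has_vector_derivative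
      (\<Sum>j\<in>UNIV. (v $ i * v $ j) *\<^sub>R f2 i j (x + h *\<^sub>R v))) (at h)" for i
    using bounded_linear.has_vector_derivative[OF bounded_linear_scaleR_right]
    by (fastforce simp: scaleR_sum_right)
  then show "((\<lambda>h. \<Sum>i\<in>UNIV. (v $ i) *\<^sub>R f1 i (x + h *\<^sub>R v)) has_vector_derivative
      (\<Sum>i\<in>UNIV. \<Sum>j\<in>UNIV. (v $ i * v $ j) *\<^sub>R f2 i j (x + h *\<^sub>R v))) (at h)"
    by (intro has_vector_derivative_sum)
qed

lemma jet2_line_jet:
  fixes f :: "real^'d::finite \<Rightarrow> real"
  assumes "jet2 f f1 f2"
  shows "line_jet f x (\<lambda>i. f1 i x) (\<lambda>i j. f2 i j x)"
  unfolding line_jet_def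
proof
  fix v
  show "\<exists>F'. (\<forall>\<^sub>F h in nhds 0. ((\<lambda>k. f (x + k *\<^sub>R v)) has_real_derivative F' h) (at h)) \<and>
      F' 0 = (\<Sum>i\<in>UNIV. v $ i * f1 i x) \<and>
      (F' has_real_derivative (\<Sum>i\<in>UNIV. \<Sum>j\<in>UNIV. v $ i * v $ j * f2 i j x)) (at 0)"
    using jet2_along_line(1)[OF assms, where x = x and v = v] jet2_along_line(2)[OF assms, where x = x and v = v and h = 0]
    by (intro exI[of _ "\<lambda>h. \<Sum>i\<in>UNIV. (v $ i) *\<^sub>R f1 i (x + h *\<^sub>R v)"])
       (simp add: has_real_derivative_iff_has_vector_derivative)
qed

lemma norm_powr_eq_inner_powr: "norm (y::'b::real_inner) powr p = (y \<bullet> y) powr (p / 2)"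
  by (cases "y = 0") (simp_all add: powr_powr power2_norm_eq_inner[symmetric] flip: powr_numeral)

lemma has_real_derivative_inner_powr:
  fixes Y :: "real \<Rightarrow> 'b::real_inner"
  assumes "(Y has_vector_derivative Y') (at t)" "Y t \<noteq> 0"
  shows "((\<lambda>t. (Y t \<bullet> Y t) powr r) has_real_derivative
    r * (Y t \<bullet> Y t) powr (r - 1) * (2 * (Y t \<bullet> Y'))) (at t)"
proof -
  have "((\<lambda>t. Y t \<bullet> Y t) has_real_derivative 2 * (Y t \<bullet> Y')) (at t)"
    using assms(1) unfolding has_real_derivative_iff_has_vector_derivative
    by (auto intro!: derivative_eq_intros simp: has_vector_derivative_def inner_commute algebra_simps)
  moreover have "0 < Y t \<bullet> Y t" using assms(2) by simp
  ultimately show ?thesis by (intro DERIV_chain2[OF has_real_derivative_powr])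
qed

text \<open>Along a line, \<open>|f|\<^sup>p = (f \<bullet> f)\<^bsup>p/2\<^esup>\<close>, which is smooth as long as \<open>f\<close> does not vanish. By continuity
  this is so near every point with \<open>f x \<noteq> 0\<close>.\<close>

lemma norm_powr_line_jet:
  fixes f :: "real^'d::finite \<Rightarrow> 'b::real_inner"
  assumes f: "jet2 f f1 f2" and "f x \<noteq> 0"
  defines "w \<equiv> f x" and "P \<equiv> \<lambda>i. f1 i x"
  shows "line_jet (\<lambda>y. norm (f y) powr p) x
    (\<lambda>i. p * (w \<bullet> w) powr (p / 2 - 1) * (w \<bullet> P i))
    (\<lambda>i j. p * (w \<bullet> w) powr (p / 2 - 1) *
      ((p - 2) / (w \<bullet> w) * ((w \<bullet> P i) * (w \<bullet> P j)) + P i \<bullet> P j + w \<bullet> f2 i j x))"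
  unfolding line_jet_def
proof
  fix v
  define Y where "Y h = f (x + h *\<^sub>R v)" for h
  define Y' where "Y' h = (\<Sum>i\<in>UNIV. (v $ i) *\<^sub>R f1 i (x + h *\<^sub>R v))" for h
  define Y'' where "Y'' = (\<Sum>i\<in>UNIV. \<Sum>j\<in>UNIV. (v $ i * v $ j) *\<^sub>R f2 i j x)"
  have dY: "(Y has_vector_derivative Y' h) (at h)" for h
    using jet2_along_line(1)[OF f, where x = x and v = v and h = h] by (simp add: Y_def[abs_def] Y'_def)
  have dY': "(Y' has_vector_derivative Y'') (at 0)"
    using jet2_along_line(2)[OF f, where x = x and v = v and h = 0] by (simp add: Y'_def[abs_def] Y''_def)
  have Y0: "Y 0 = w" "Y' 0 = (\<Sum>i\<in>UNIV. (v $ i) *\<^sub>R P i)" by (simp_all add: Y_def Y'_def w_def P_def)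
  have w0: "w \<noteq> 0" using assms(2) by (simp add: w_def)
  have "isCont Y 0" using dY[of 0] by (rule has_vector_derivative_continuous)
  then have ev: "\<forall>\<^sub>F h in nhds 0. Y h \<noteq> 0"
    unfolding isCont_def tendsto_at_iff_tendsto_nhds
    by (rule tendsto_imp_eventually_ne) (simp add: w0 Y0)
  show "\<exists>F'. (\<forall>\<^sub>F h in nhds 0. ((\<lambda>k. norm (f (x + k *\<^sub>R v)) powr p) has_real_derivative F' h) (at h)) \<and>
      F' 0 = (\<Sum>i\<in>UNIV. v $ i * (p * (w \<bullet> w) powr (p / 2 - 1) * (w \<bullet> P i))) \<and>
      (F' has_real_derivative (\<Sum>i\<in>UNIV. \<Sum>j\<in>UNIV. v $ i * v $ j *
        (p * (w \<bullet> w) powr (p / 2 - 1) *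
          ((p - 2) / (w \<bullet> w) * ((w \<bullet> P i) * (w \<bullet> P j)) + P i \<bullet> P j + w \<bullet> f2 i j x)))) (at 0)"
  proof (intro exI[of _ "\<lambda>h. p * (Y h \<bullet> Y h) powr (p / 2 - 1) * (Y h \<bullet> Y' h)"] conjI)
    show "\<forall>\<^sub>F h in nhds 0. ((\<lambda>k. norm (f (x + k *\<^sub>R v)) powr p) has_real_derivative
        p * (Y h \<bullet> Y h) powr (p / 2 - 1) * (Y h \<bullet> Y' h)) (at h)"
      using ev
    proof eventually_elim
      case (elim h)
      then show ?case
        using has_real_derivative_inner_powr[OF dY elim, of "p / 2"]
        by (simp add: norm_powr_eq_inner_powr Y_def[symmetric] mult.assoc)
    qed
    show "p * (Y 0 \<bullet> Y 0) powr (p / 2 - 1) * (Y 0 \<bullet> Y' 0)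
        = (\<Sum>i\<in>UNIV. v $ i * (p * (w \<bullet> w) powr (p / 2 - 1) * (w \<bullet> P i)))"
      unfolding Y0 inner_sum_right sum_distrib_left
      by (intro sum.cong refl) simp
    have in1: "((\<lambda>h. Y h \<bullet> Y' h) has_real_derivative (Y' 0 \<bullet> Y' 0 + Y 0 \<bullet> Y'')) (at 0)"
      using has_derivative_inner[OF dY[of 0, unfolded has_vector_derivative_def] dY'[unfolded has_vector_derivative_def]]
      unfolding has_field_derivative_def
      by (rule has_derivative_eq_rhs) (auto simp: algebra_simps inner_commute)
    have der: "((\<lambda>h. p * (Y h \<bullet> Y h) powr (p / 2 - 1) * (Y h \<bullet> Y' h)) has_real_derivative
        p * ((p / 2 - 1) * (w \<bullet> w) powr (p / 2 - 1 - 1) * (2 * (w \<bullet> Y' 0))) * (w \<bullet> Y' 0)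
        + p * (w \<bullet> w) powr (p / 2 - 1) * (Y' 0 \<bullet> Y' 0 + w \<bullet> Y'')) (at 0)"
      using DERIV_mult[OF DERIV_cmult[OF has_real_derivative_inner_powr[OF dY, of 0 "p / 2 - 1"], of p] in1] w0
      by (simp add: Y0(1) algebra_simps)
    have pw: "(w \<bullet> w) powr (p / 2 - 1 - 1) = (w \<bullet> w) powr (p / 2 - 1) / (w \<bullet> w)"
      using w0 by (subst powr_diff) auto
    have quad: "(\<Sum>i\<in>UNIV. \<Sum>j\<in>UNIV. v $ i * v $ j *
        (p * (w \<bullet> w) powr (p / 2 - 1) *
          ((p - 2) / (w \<bullet> w) * ((w \<bullet> P i) * (w \<bullet> P j)) + P i \<bullet> P j + w \<bullet> f2 i j x)))
      = p * (w \<bullet> w) powr (p / 2 - 1) *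
          ((p - 2) / (w \<bullet> w) * ((w \<bullet> Y' 0) * (w \<bullet> Y' 0)) + Y' 0 \<bullet> Y' 0 + w \<bullet> Y'')"
    proof -
      have "(w \<bullet> Y' 0) * (w \<bullet> Y' 0) = (\<Sum>i\<in>UNIV. \<Sum>j\<in>UNIV. v $ i * v $ j * ((w \<bullet> P i) * (w \<bullet> P j)))"
        by (simp add: Y0 inner_sum_right sum_product mult_ac)
      moreover have "Y' 0 \<bullet> Y' 0 = (\<Sum>i\<in>UNIV. \<Sum>j\<in>UNIV. v $ i * v $ j * (P i \<bullet> P j))"
        by (simp add: Y0 inner_sum_left inner_sum_right sum_distrib_left mult_ac inner_commute)
      moreover have "w \<bullet> Y'' = (\<Sum>i\<in>UNIV. \<Sum>j\<in>UNIV. v $ i * v $ j * (w \<bullet> f2 i j x))"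
        by (simp add: Y''_def inner_sum_right)
      ultimately show ?thesis
        by (simp only: sum_distrib_left sum.distrib[symmetric]) (intro sum.cong refl, simp add: algebra_simps)
    qed
    show "((\<lambda>h. p * (Y h \<bullet> Y h) powr (p / 2 - 1) * (Y h \<bullet> Y' h)) has_real_derivative
      (\<Sum>i\<in>UNIV. \<Sum>j\<in>UNIV. v $ i * v $ j *
        (p * (w \<bullet> w) powr (p / 2 - 1) *
          ((p - 2) / (w \<bullet> w) * ((w \<bullet> P i) * (w \<bullet> P j)) + P i \<bullet> P j + w \<bullet> f2 i j x)))) (at 0)"
      unfolding quad using der unfolding pw
      by (rule DERIV_cong) (use w0 in \<open>simp add: field_simps\<close>)
  qed
qed

section \<open>The maximum principle with a Lyapunov function\<close>

text \<open>On the time strip \<open>[s, T]\<close>, the operator \<open>A = tr (q D\<^sup>2) + \<langle>a, D\<rangle>\<close> is degenerate elliptic and has a Lyapunov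
  function \<open>\<phi>\<close>, which replaces boundary conditions at infinity.\<close>

locale lyapunov_strip =
  fixes q :: "real \<Rightarrow> real^'d \<Rightarrow> real^'d^'d::finite" and a :: "'d \<Rightarrow> real \<Rightarrow> real^'d \<Rightarrow> real"
    and s T :: real and \<phi> :: "real^'d \<Rightarrow> real" and l m :: real
  assumes q_sym: "\<And>t x. t \<in> {s..T} \<Longrightarrow> transpose (q t x) = q t x"
    and q_psd: "\<And>t x v. t \<in> {s..T} \<Longrightarrow> 0 \<le> v \<bullet> (q t x *v v)"
    and \<phi>_C2: "C2_fun \<phi>" and \<phi>_pos: "\<And>x. \<phi> x > 0" and \<phi>_lim: "filterlim \<phi> at_top at_infinity"
    and l_pos: "l > 0"
    and \<phi>_lyapunov: "\<And>t x. t \<in> {s<..T} \<Longrightarrow>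
      (\<Sum>i\<in>UNIV. \<Sum>j\<in>UNIV. q t x $ i $ j * partial_deriv j (partial_deriv i \<phi>) x)
        + (\<Sum>i\<in>UNIV. a i t x * partial_deriv i \<phi> x) \<le> l * \<phi> x + m"
begin

text \<open>Suppose that \<open>z\<close> is positive somewhere. After damping by \<open>exp (- \<mu> t)\<close> and subtraction of a small
  multiple of \<open>\<phi> + k\<close>, it still is, and now it attains a maximum, because \<open>\<phi>\<close> blows up while \<open>z\<close> is
  bounded. There the gradient vanishes, the Hessian is negative semidefinite and the time derivative is
  nonnegative, which contradicts the differential inequality, as \<open>exp (\<mu> t) (\<phi> + k)\<close> is a
  supersolution for large \<open>k\<close> and \<open>\<mu>\<close>. Since the maximum is positive, the differential inequality is only ever
  used where \<open>z\<close> is positive.\<close>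

lemma maximum_principle:
  fixes z :: "real \<Rightarrow> real^'d \<Rightarrow> real"
  assumes cont: "continuous_on ({s..T} \<times> UNIV) (\<lambda>(t, x). z t x)"
    and bdd: "\<And>t x. t \<in> {s..T} \<Longrightarrow> z t x \<le> M"
    and init: "\<And>x. z s x \<le> 0"
    and sub: "\<And>t x. t \<in> {s<..T} \<Longrightarrow> z t x > 0 \<Longrightarrow>
      \<exists>D g H. ((\<lambda>\<tau>. z \<tau> x) has_real_derivative D) (at t) \<and> line_jet (z t) x g H \<and>
        D \<le> (\<Sum>i\<in>UNIV. \<Sum>j\<in>UNIV. q t x $ i $ j * H i j) + (\<Sum>i\<in>UNIV. a i t x * g i) + c * z t x"
    and t: "t \<in> {s..T}"
  shows "z t x \<le> 0"
proof (rule ccontr)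
  assume "\<not> z t x \<le> 0"
  have \<phi>_cont: "continuous_on UNIV \<phi>" using \<phi>_C2 by (simp add: C2_fun_def)
  \<comment> \<open>The choice of \<open>k\<close> gives \<open>m - l * k \<le> 0\<close>; that of \<open>\<delta>\<close> halves the damped value of \<open>z\<close> at \<open>(t, x)\<close>.\<close>
  define \<mu> where "\<mu> = max c 0 + l"
  define k where "k = \<bar>m\<bar> / l"
  define \<delta> where "\<delta> = exp (- \<mu> * (t - s)) * z t x / (2 * (\<phi> x + k))"
  define Z where "Z t x = exp (- \<mu> * (t - s)) * z t x - \<delta> * \<phi> x + (- \<delta> * k)" for t x
  have k0: "k \<ge> 0" using l_pos by (simp add: k_def)
  have "\<phi> x + k > 0" using \<phi>_pos[of x] k0 by linarith
  then have \<delta>: "\<delta> > 0" using \<open>\<not> z t x \<le> 0\<close> by (simp add: \<delta>_def)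
  have "\<delta> * (\<phi> x + k) = exp (- \<mu> * (t - s)) * z t x / 2"
    using \<open>\<phi> x + k > 0\<close> by (simp add: \<delta>_def field_simps)
  then have "Z t x = exp (- \<mu> * (t - s)) * z t x / 2" by (simp add: Z_def algebra_simps)
  moreover have "exp (- \<mu> * (t - s)) * z t x > 0" using \<open>\<not> z t x \<le> 0\<close> by (intro mult_pos_pos) auto
  ultimately have pos: "Z t x > 0" by simp
  have "\<mu> \<ge> 0" using l_pos by (simp add: \<mu>_def)
  have bound: "exp (- \<mu> * (t - s)) * z t x \<le> \<bar>M\<bar>" if "t \<in> {s..T}" for t x
  proof -
    have "exp (- \<mu> * (t - s)) * z t x \<le> exp (- \<mu> * (t - s)) * \<bar>M\<bar>"
      using bdd[OF that, of x] by (intro mult_left_mono) auto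
    also have "\<dots> \<le> 1 * \<bar>M\<bar>" using that \<open>\<mu> \<ge> 0\<close> by (intro mult_right_mono) auto
    finally show ?thesis by simp
  qed
  obtain R where R: "\<And>x. norm x \<ge> R \<Longrightarrow> \<phi> x \<ge> (\<bar>M\<bar> + 1) / \<delta>"
    using \<phi>_lim unfolding filterlim_at_top eventually_at_infinity by meson
  have outside: "Z t x < 0" if "t \<in> {s..T}" "norm x \<ge> R" for t x
  proof -
    have "\<delta> * \<phi> x \<ge> \<bar>M\<bar> + 1" using R[OF that(2)] \<delta> by (simp add: field_simps)
    moreover have "\<delta> * k \<ge> 0" using \<delta> k0 by simp
    ultimately show ?thesis using bound[OF that(1), of x] by (simp add: Z_def)
  qed
  let ?K = "{s..T} \<times> cball (0::real^'d) R"
  have in_K: "(t, x) \<in> ?K" using t outside[OF t, of x] pos by force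
  have contz: "continuous_on ?K (\<lambda>p. z (fst p) (snd p))"
    using cont by (auto simp: case_prod_beta' intro: continuous_on_subset)
  have cont\<phi>: "continuous_on ?K (\<lambda>p. \<phi> (snd p))"
    by (intro continuous_on_compose2[OF \<phi>_cont] continuous_intros) auto
  have "continuous_on ?K (\<lambda>p. Z (fst p) (snd p))"
    unfolding Z_def by (intro continuous_intros contz cont\<phi>)
  moreover have "compact ?K" by (intro compact_Times compact_Icc compact_cball)
  ultimately obtain p where p: "p \<in> ?K" "\<And>r. r \<in> ?K \<Longrightarrow> Z (fst r) (snd r) \<le> Z (fst p) (snd p)"
    using continuous_attains_sup[of ?K "\<lambda>p. Z (fst p) (snd p)"] in_K by blast
  obtain t\<^sub>0 x\<^sub>0 where p_eq: "p = (t\<^sub>0, x\<^sub>0)" by (cases p)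
  have t0: "t\<^sub>0 \<in> {s..T}" using p(1) p_eq by simp
  have Z0: "Z t\<^sub>0 x\<^sub>0 > 0" using p(2)[OF in_K] pos p_eq by simp
  have max: "Z \<tau> y \<le> Z t\<^sub>0 x\<^sub>0" if "\<tau> \<in> {s..T}" for \<tau> y
    using p(2)[of "(\<tau>, y)"] outside[OF that, of y] Z0 that p_eq by (cases "norm y \<ge> R") auto
  define E where "E = exp (- \<mu> * (t\<^sub>0 - s))"
  have "E > 0" by (simp add: E_def)
  have z0: "E * z t\<^sub>0 x\<^sub>0 > \<delta> * (\<phi> x\<^sub>0 + k)" using Z0 by (simp add: Z_def E_def algebra_simps)
  moreover have "\<delta> * (\<phi> x\<^sub>0 + k) > 0" using \<delta> \<phi>_pos[of x\<^sub>0] k0 by simp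
  ultimately have Ez: "E * z t\<^sub>0 x\<^sub>0 > 0" by linarith
  then have zpos: "z t\<^sub>0 x\<^sub>0 > 0" using \<open>E > 0\<close> by (simp add: zero_less_mult_iff)
  have "t\<^sub>0 \<noteq> s" using init[of x\<^sub>0] zpos by auto
  then have t0': "t\<^sub>0 \<in> {s<..T}" using t0 by auto
  obtain D g H where D: "((\<lambda>\<tau>. z \<tau> x\<^sub>0) has_real_derivative D) (at t\<^sub>0)"
    and jet: "line_jet (z t\<^sub>0) x\<^sub>0 g H"
    and ineq: "D \<le> (\<Sum>i\<in>UNIV. \<Sum>j\<in>UNIV. q t\<^sub>0 x\<^sub>0 $ i $ j * H i j)
        + (\<Sum>i\<in>UNIV. a i t\<^sub>0 x\<^sub>0 * g i) + c * z t\<^sub>0 x\<^sub>0"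
    using sub[OF t0' zpos] by blast
  have "E * (D - \<mu> * z t\<^sub>0 x\<^sub>0) \<ge> 0"
  proof (rule ccontr)
    assume "\<not> E * (D - \<mu> * z t\<^sub>0 x\<^sub>0) \<ge> 0"
    moreover have "((\<lambda>\<tau>. Z \<tau> x\<^sub>0) has_real_derivative E * (D - \<mu> * z t\<^sub>0 x\<^sub>0)) (at t\<^sub>0)"
      unfolding Z_def E_def using D by (auto intro!: derivative_eq_intros simp: algebra_simps)
    ultimately obtain d where d: "d > 0" "\<And>h. 0 < h \<Longrightarrow> h < d \<Longrightarrow> Z t\<^sub>0 x\<^sub>0 < Z (t\<^sub>0 - h) x\<^sub>0"
      using DERIV_neg_dec_left[of "\<lambda>\<tau>. Z \<tau> x\<^sub>0"] by (meson not_le)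
    define h where "h = min d (t\<^sub>0 - s) / 2"
    have "0 < h" "h < d" "t\<^sub>0 - h \<in> {s..T}" using d(1) t0' by (auto simp: h_def min_def field_simps)
    with d(2)[of h] max[of "t\<^sub>0 - h" x\<^sub>0] show False by simp
  qed
  moreover have "line_jet (Z t\<^sub>0) x\<^sub>0 (\<lambda>i. E * g i - \<delta> * partial_deriv i \<phi> x\<^sub>0) (\<lambda>i j. E * H i j - \<delta> * partial_deriv j (partial_deriv i \<phi>) x\<^sub>0)"
    using line_jet_linear_combination[OF jet jet2_line_jet[OF C2_fun_jet2[OF \<phi>_C2]], of E \<delta> "- \<delta> * k"]
    unfolding Z_def[abs_def] E_def by simp
  note * = line_jet_at_max[OF this max[OF t0]]
  have "(\<Sum>i\<in>UNIV. \<Sum>j\<in>UNIV. q t\<^sub>0 x\<^sub>0 $ i $ j * (E * H i j - \<delta> * partial_deriv j (partial_deriv i \<phi>) x\<^sub>0)) \<le> 0"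
  proof (rule trace_psd_nsd_nonpos)
    show "q t\<^sub>0 x\<^sub>0 $ i $ j = q t\<^sub>0 x\<^sub>0 $ j $ i" for i j
      using q_sym[OF t0, of x\<^sub>0] by (simp add: transpose_def vec_eq_iff)
    show "0 \<le> (\<Sum>i\<in>UNIV. \<Sum>j\<in>UNIV. w i * w j * q t\<^sub>0 x\<^sub>0 $ i $ j)" for w
      using q_psd[OF t0, of "\<chi> i. w i" x\<^sub>0]
      by (simp add: inner_vec_def matrix_vector_mult_def sum_distrib_left mult_ac)
  qed (simp_all add: *(2))
  then have "E * (\<Sum>i\<in>UNIV. \<Sum>j\<in>UNIV. q t\<^sub>0 x\<^sub>0 $ i $ j * H i j)
      \<le> \<delta> * (\<Sum>i\<in>UNIV. \<Sum>j\<in>UNIV. q t\<^sub>0 x\<^sub>0 $ i $ j * partial_deriv j (partial_deriv i \<phi>) x\<^sub>0)"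
    by (simp add: sum_distrib_left algebra_simps sum_subtractf)
  moreover have "E * (\<Sum>i\<in>UNIV. a i t\<^sub>0 x\<^sub>0 * g i) = \<delta> * (\<Sum>i\<in>UNIV. a i t\<^sub>0 x\<^sub>0 * partial_deriv i \<phi> x\<^sub>0)"
  proof -
    have "E * (a i t\<^sub>0 x\<^sub>0 * g i) = \<delta> * (a i t\<^sub>0 x\<^sub>0 * partial_deriv i \<phi> x\<^sub>0)" for i
      using *(1)[of i] by (simp add: mult.left_commute)
    then show ?thesis unfolding sum_distrib_left by (rule sum.cong[OF refl])
  qed
  moreover have "E * D \<le> E * ((\<Sum>i\<in>UNIV. \<Sum>j\<in>UNIV. q t\<^sub>0 x\<^sub>0 $ i $ j * H i j)
        + (\<Sum>i\<in>UNIV. a i t\<^sub>0 x\<^sub>0 * g i) + c * z t\<^sub>0 x\<^sub>0)"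
    using ineq \<open>E > 0\<close> by simp
  moreover have "\<delta> * ((\<Sum>i\<in>UNIV. \<Sum>j\<in>UNIV. q t\<^sub>0 x\<^sub>0 $ i $ j * partial_deriv j (partial_deriv i \<phi>) x\<^sub>0)
        + (\<Sum>i\<in>UNIV. a i t\<^sub>0 x\<^sub>0 * partial_deriv i \<phi> x\<^sub>0)) \<le> \<delta> * (l * \<phi> x\<^sub>0 + m)"
    using \<phi>_lyapunov[OF t0', of x\<^sub>0] \<delta> by simp
  ultimately have "0 \<le> \<delta> * (l * \<phi> x\<^sub>0 + m) + (c - \<mu>) * (E * z t\<^sub>0 x\<^sub>0)"
    by (simp add: algebra_simps)
  also have "(c - \<mu>) * (E * z t\<^sub>0 x\<^sub>0) \<le> - l * (E * z t\<^sub>0 x\<^sub>0)"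
    using Ez by (intro mult_right_mono) (auto simp: \<mu>_def)
  also have "- l * (E * z t\<^sub>0 x\<^sub>0) < - l * (\<delta> * (\<phi> x\<^sub>0 + k))" using z0 l_pos by simp
  also have "\<delta> * (l * \<phi> x\<^sub>0 + m) + - l * (\<delta> * (\<phi> x\<^sub>0 + k)) = \<delta> * (m - \<bar>m\<bar>)"
    using l_pos by (simp add: k_def field_simps)
  also have "\<dots> \<le> 0" using \<delta> by (simp add: mult_le_0_iff)
  finally show False by simp
qed

end

section \<open>The pointwise dissipation inequality\<close>

text \<open>Each of the two vectors contributes a factor \<open>sqrt CARD('m)\<close> when its sum norm is estimated by its
  Euclidean norm.\<close>

lemma abs_inner_matrix_vector_le:
  fixes N :: "real^'m^'m::finite"
  assumes "\<And>j k. \<bar>N $ j $ k\<bar> \<le> r"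
  shows "\<bar>w \<bullet> (N *v y)\<bar> \<le> r * CARD('m) * (norm w * norm y)"
proof -
  have r: "r \<ge> 0" using assms by (meson abs_ge_zero order_trans)
  have L1: "(\<Sum>i\<in>UNIV. \<bar>u $ i\<bar>) \<le> sqrt CARD('m) * norm u" for u :: "real^'m"
  proof -
    have "(\<Sum>i\<in>UNIV. 1 * \<bar>u $ i\<bar>) \<le> L2_set (\<lambda>i::'m. 1::real) UNIV * L2_set (\<lambda>i. \<bar>u $ i\<bar>) UNIV"
      using L2_set_mult_ineq[of "\<lambda>i::'m. 1::real" "\<lambda>i. \<bar>u $ i\<bar>" UNIV] by simp
    then show ?thesis by (simp add: L2_set_def norm_vec_def)
  qed
  have "\<bar>w \<bullet> (N *v y)\<bar> \<le> (\<Sum>j\<in>UNIV. \<Sum>k\<in>UNIV. \<bar>w $ j * (N $ j $ k * y $ k)\<bar>)"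
    unfolding inner_vec_def matrix_vector_mult_def
    by (simp add: sum_distrib_left) (intro order_trans[OF sum_abs] sum_mono sum_abs)
  also have "\<dots> \<le> (\<Sum>j\<in>UNIV. \<Sum>k\<in>UNIV. r * (\<bar>w $ j\<bar> * \<bar>y $ k\<bar>))"
  proof (intro sum_mono)
    fix j k
    have "\<bar>N $ j $ k\<bar> * (\<bar>w $ j\<bar> * \<bar>y $ k\<bar>) \<le> r * (\<bar>w $ j\<bar> * \<bar>y $ k\<bar>)"
      using assms by (intro mult_right_mono) auto
    then show "\<bar>w $ j * (N $ j $ k * y $ k)\<bar> \<le> r * (\<bar>w $ j\<bar> * \<bar>y $ k\<bar>)"
      by (simp add: abs_mult mult_ac)
  qed
  also have "\<dots> = r * ((\<Sum>j\<in>UNIV. \<bar>w $ j\<bar>) * (\<Sum>k\<in>UNIV. \<bar>y $ k\<bar>))"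
    unfolding sum_product by (simp add: sum_distrib_left)
  also have "\<dots> \<le> r * ((sqrt CARD('m) * norm w) * (sqrt CARD('m) * norm y))"
    using r by (intro mult_left_mono mult_mono L1) (auto intro: sum_nonneg)
  also have "\<dots> = r * CARD('m) * (norm w * norm y)" by simp
  finally show ?thesis .
qed

lemma quadratic_form_sum: "(\<Sum>i\<in>UNIV. \<Sum>j\<in>UNIV. Q $ i $ j * (z i * z j)) = (\<chi> i. z i) \<bullet> (Q *v (\<chi> i. z i))"
  by (simp add: inner_vec_def matrix_vector_mult_def sum_distrib_left mult_ac)

text \<open>The algebraic core, with \<open>w\<close> in the role of \<open>u\<close> and \<open>P i\<close> in that of \<open>D\<^sub>i u\<close>. The coupling terms
  \<open>w \<bullet> N i P i\<close> are linear in \<open>P\<close> and are absorbed, by Young's inequality, into the part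
  \<open>\<gamma> \<theta> |P|\<^sup>2\<close> of the dissipation; the price is \<open>|w|\<^sup>2 / (4 \<gamma> \<theta>)\<close> times the squared coupling strength.
  How large \<open>\<gamma>\<close> may be depends on \<open>p\<close>: the term with factor \<open>p - 2\<close> helps if \<open>p \<ge> 2\<close>, whereas for
  \<open>p < 2\<close> the Cauchy-Schwarz inequality shows that it consumes at most the share \<open>2 - p\<close> of the
  dissipation, so that \<open>p - 1\<close> is left.\<close>

lemma dissipation_inequality:
  fixes Q :: "real^'d^'d::finite" and N :: "'d \<Rightarrow> real^'m^'m::finite" and C :: "real^'m^'m"
    and w :: "real^'m" and P :: "'d \<Rightarrow> real^'m"
  assumes sym: "transpose Q = Q" "transpose C = C"
    and lam: "\<theta> = min_eigenvalue Q" "\<theta> > 0"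
    and N: "\<And>i j k. \<bar>N i $ j $ k\<bar> \<le> \<xi> * \<theta> powr \<sigma>"
    and w: "w \<noteq> 0"
    and \<gamma>: "0 < \<gamma>" "\<gamma> \<le> 1" "\<gamma> \<le> p - 1"
    and \<kappa>: "1 / (4 * \<gamma>) \<le> \<kappa>"
    and K: "max_eigenvalue C + \<kappa> * real CARD('d) * (real CARD('m))\<^sup>2 * \<xi>\<^sup>2 * \<theta> powr (2 * \<sigma> - 1) \<le> K"
  shows "w \<bullet> ((\<Sum>i\<in>UNIV. N i *v P i) + C *v w)
      - (\<Sum>i\<in>UNIV. \<Sum>j\<in>UNIV. Q $ i $ j * (P i \<bullet> P j))
      - (p - 2) / (w \<bullet> w) * (\<Sum>i\<in>UNIV. \<Sum>j\<in>UNIV. Q $ i $ j * ((w \<bullet> P i) * (w \<bullet> P j)))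
    \<le> K * (w \<bullet> w)"
proof -
  define m where "m = real CARD('m)"
  define r where "r = \<xi> * \<theta> powr \<sigma> * m"
  define A where "A = (\<Sum>i\<in>UNIV. \<Sum>j\<in>UNIV. Q $ i $ j * (P i \<bullet> P j))"
  define A' where "A' = (\<Sum>i\<in>UNIV. \<Sum>j\<in>UNIV. Q $ i $ j * ((w \<bullet> P i) * (w \<bullet> P j)))"
  define S where "S = (\<Sum>i\<in>UNIV. (norm (P i))\<^sup>2)"
  have ww: "w \<bullet> w > 0" using w by simp
  have psd: "v \<bullet> (Q *v v) \<ge> \<theta> * (norm v)\<^sup>2" for v
    using quadratic_form_ge_min_eigenvalue[OF sym(1)] lam(1) by simp
  have psd0: "v \<bullet> (Q *v v) \<ge> 0" for v
    using psd[of v] lam(2) by (meson less_imp_le mult_nonneg_nonneg order_trans zero_le_power2)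
  \<comment> \<open>Ellipticity, applied to the gradient of each component of \<open>u\<close>.\<close>
  have A: "A \<ge> \<theta> * S"
  proof -
    have "\<theta> * S = (\<Sum>k\<in>UNIV. \<theta> * (norm (\<chi> i. P i $ k))\<^sup>2)"
      unfolding S_def power2_norm_eq_inner
      by (simp add: inner_vec_def sum_distrib_left) (rule sum.swap)
    also have "\<dots> \<le> (\<Sum>k\<in>UNIV. (\<chi> i. P i $ k) \<bullet> (Q *v (\<chi> i. P i $ k)))"
      by (intro sum_mono psd)
    also have "\<dots> = (\<Sum>k\<in>UNIV. \<Sum>i\<in>UNIV. \<Sum>j\<in>UNIV. Q $ i $ j * (P i $ k * P j $ k))"
      by (simp only: quadratic_form_sum)
    also have "\<dots> = (\<Sum>i\<in>UNIV. \<Sum>k\<in>UNIV. \<Sum>j\<in>UNIV. Q $ i $ j * (P i $ k * P j $ k))"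
      by (rule sum.swap)
    also have "\<dots> = (\<Sum>i\<in>UNIV. \<Sum>j\<in>UNIV. \<Sum>k\<in>UNIV. Q $ i $ j * (P i $ k * P j $ k))"
      by (intro sum.cong refl) (rule sum.swap)
    also have "\<dots> = A" by (simp add: A_def inner_vec_def sum_distrib_left)
    finally show ?thesis .
  qed
  have A'0: "A' \<ge> 0" unfolding A'_def quadratic_form_sum by (rule psd0)
  have A'A: "A' \<le> (w \<bullet> w) * A"
  proof -
    \<comment> \<open>By Cauchy-Schwarz the matrix of the differences is negative semidefinite.\<close>
    have "(\<Sum>i\<in>UNIV. \<Sum>j\<in>UNIV. Q $ i $ j * ((w \<bullet> P i) * (w \<bullet> P j) - (w \<bullet> w) * (P i \<bullet> P j))) \<le> 0"
    proof (rule trace_psd_nsd_nonpos)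
      show "Q $ i $ j = Q $ j $ i" for i j using sym(1) by (simp add: transpose_def vec_eq_iff)
      show "0 \<le> (\<Sum>i\<in>UNIV. \<Sum>j\<in>UNIV. z i * z j * Q $ i $ j)" for z
        using psd0[of "\<chi> i. z i"] by (simp add: quadratic_form_sum[symmetric] mult_ac)
      show "(\<Sum>i\<in>UNIV. \<Sum>j\<in>UNIV. z i * z j * ((w \<bullet> P i) * (w \<bullet> P j) - (w \<bullet> w) * (P i \<bullet> P j))) \<le> 0" for z
      proof -
        define y where "y = (\<Sum>i\<in>UNIV. z i *\<^sub>R P i)"
        have "(\<Sum>i\<in>UNIV. \<Sum>j\<in>UNIV. z i * z j * ((w \<bullet> P i) * (w \<bullet> P j) - (w \<bullet> w) * (P i \<bullet> P j)))
            = (w \<bullet> y)\<^sup>2 - (w \<bullet> w) * (y \<bullet> y)"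
          by (simp add: y_def power2_eq_square sum_product inner_sum_left inner_sum_right
              sum_distrib_left sum_subtractf algebra_simps inner_commute)
        with Cauchy_Schwarz_ineq[of w y] show ?thesis by simp
      qed
    qed simp
    then show ?thesis by (simp add: A_def A'_def algebra_simps sum_subtractf sum_distrib_left)
  qed
  have "A \<ge> 0" using A lam(2) by (smt (verit) S_def mult_nonneg_nonneg sum_nonneg zero_le_power2)
  have diss: "A + (p - 2) / (w \<bullet> w) * A' \<ge> \<gamma> * A"
  proof (cases "p \<ge> 2")
    case True
    then have "(p - 2) / (w \<bullet> w) * A' \<ge> 0" using ww A'0 by simp
    moreover have "\<gamma> * A \<le> 1 * A" using \<gamma>(2) \<open>A \<ge> 0\<close> by (intro mult_right_mono)
    ultimately show ?thesis by linarith
  next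
    case False
    have "A' / (w \<bullet> w) \<le> A" using A'A ww by (simp add: field_simps)
    then have "(p - 2) * (A' / (w \<bullet> w)) \<ge> (p - 2) * A" using False by (intro mult_left_mono_neg) auto
    moreover have "\<gamma> * A \<le> (p - 1) * A" using \<gamma>(3) \<open>A \<ge> 0\<close> by (intro mult_right_mono)
    ultimately show ?thesis by (simp add: algebra_simps)
  qed
  have one: "w \<bullet> (N i *v P i) \<le> \<gamma> * \<theta> * (norm (P i))\<^sup>2 + r\<^sup>2 / (4 * \<gamma> * \<theta>) * (w \<bullet> w)" for i
  proof -
    have "w \<bullet> (N i *v P i) \<le> r * (norm w * norm (P i))"
      using abs_inner_matrix_vector_le[of "N i" "\<xi> * \<theta> powr \<sigma>" w "P i"] N by (simp add: r_def m_def)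
    also have "\<dots> \<le> \<gamma> * \<theta> * (norm (P i))\<^sup>2 + r\<^sup>2 / (4 * \<gamma> * \<theta>) * (norm w)\<^sup>2"
    proof -
      \<comment> \<open>Young's inequality, as a completed square.\<close>
      define c where "c = \<gamma> * \<theta>"
      have "c > 0" using \<gamma>(1) lam(2) by (simp add: c_def)
      have "0 \<le> (2 * c * norm (P i) - r * norm w)\<^sup>2 / (4 * c)" using \<open>c > 0\<close> by simp
      also have "\<dots> = c * (norm (P i))\<^sup>2 + r\<^sup>2 / (4 * c) * (norm w)\<^sup>2 - r * (norm w * norm (P i))"
        using \<open>c > 0\<close> by (simp add: field_simps power2_eq_square)
      finally show ?thesis by (simp add: c_def mult.assoc)
    qed
    finally show ?thesis by (simp add: power2_norm_eq_inner)
  qed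
  have "w \<bullet> (\<Sum>i\<in>UNIV. N i *v P i) \<le> (\<Sum>i\<in>UNIV. \<gamma> * \<theta> * (norm (P i))\<^sup>2 + r\<^sup>2 / (4 * \<gamma> * \<theta>) * (w \<bullet> w))"
    unfolding inner_sum_right by (intro sum_mono one)
  also have "\<dots> = \<gamma> * (\<theta> * S) + CARD('d) * (r\<^sup>2 / (4 * \<gamma> * \<theta>) * (w \<bullet> w))"
    by (simp add: S_def sum.distrib sum_distrib_left mult.assoc)
  also have "\<dots> \<le> \<gamma> * A + (\<kappa> * CARD('d) * m\<^sup>2 * \<xi>\<^sup>2 * \<theta> powr (2 * \<sigma> - 1)) * (w \<bullet> w)"
  proof -
    have "(\<theta> powr \<sigma>)\<^sup>2 / \<theta> = \<theta> powr (2 * \<sigma> - 1)"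
      using lam(2) by (simp add: powr_diff power2_eq_square flip: powr_add)
    moreover have "r\<^sup>2 / (4 * \<gamma> * \<theta>) = 1 / (4 * \<gamma>) * (m\<^sup>2 * \<xi>\<^sup>2 * ((\<theta> powr \<sigma>)\<^sup>2 / \<theta>))"
      by (simp add: r_def power_mult_distrib)
    ultimately have "r\<^sup>2 / (4 * \<gamma> * \<theta>) = 1 / (4 * \<gamma>) * (m\<^sup>2 * \<xi>\<^sup>2 * \<theta> powr (2 * \<sigma> - 1))"
      by simp
    also have "\<dots> \<le> \<kappa> * (m\<^sup>2 * \<xi>\<^sup>2 * \<theta> powr (2 * \<sigma> - 1))"
      using \<kappa> by (intro mult_right_mono) auto
    finally have "CARD('d) * (r\<^sup>2 / (4 * \<gamma> * \<theta>) * (w \<bullet> w))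
        \<le> CARD('d) * (\<kappa> * (m\<^sup>2 * \<xi>\<^sup>2 * \<theta> powr (2 * \<sigma> - 1)) * (w \<bullet> w))"
      using ww by (intro mult_left_mono mult_right_mono) auto
    moreover have "\<gamma> * (\<theta> * S) \<le> \<gamma> * A" using A \<gamma>(1) by simp
    ultimately show ?thesis by (simp add: mult_ac)
  qed
  finally have "w \<bullet> (\<Sum>i\<in>UNIV. N i *v P i) - A - (p - 2) / (w \<bullet> w) * A'
      \<le> (\<kappa> * CARD('d) * m\<^sup>2 * \<xi>\<^sup>2 * \<theta> powr (2 * \<sigma> - 1)) * (w \<bullet> w)"
    using diss by linarith
  moreover have "w \<bullet> (C *v w) \<le> max_eigenvalue C * (w \<bullet> w)"
    using quadratic_form_le_max_eigenvalue[OF sym(2), of w] by (simp add: power2_norm_eq_inner)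
  moreover have "(max_eigenvalue C + \<kappa> * CARD('d) * m\<^sup>2 * \<xi>\<^sup>2 * \<theta> powr (2 * \<sigma> - 1)) * (w \<bullet> w) \<le> K * (w \<bullet> w)"
    using K ww unfolding m_def by (intro mult_right_mono) auto
  ultimately show ?thesis
    unfolding A_def[symmetric] A'_def[symmetric] by (simp add: inner_add_right algebra_simps)
qed

section \<open>Comparison of vector-valued and scalar solutions\<close>

text \<open>Bounded classical solutions of \<open>D\<^sub>t u = tr (q D\<^sup>2 u) + \<langle>a, D u\<rangle> + r(Du, u)\<close> on the strip \<open>[s, T]\<close>, in nondivergence
  form. The principal part is the same for scalar and vector-valued \<open>u\<close>; the remainder \<open>r\<close> collects the terms
  that are special to the system and vanishes for the scalar equation.\<close>

definition strip_solution ::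
    "(real \<Rightarrow> real^'d \<Rightarrow> real^'d^'d::finite) \<Rightarrow> ('d \<Rightarrow> real \<Rightarrow> real^'d \<Rightarrow> real)
      \<Rightarrow> (real \<Rightarrow> real^'d \<Rightarrow> ('d \<Rightarrow> 'b) \<Rightarrow> 'b \<Rightarrow> 'b) \<Rightarrow> real \<Rightarrow> real
      \<Rightarrow> (real \<Rightarrow> real^'d \<Rightarrow> 'b::real_normed_vector) \<Rightarrow> bool" where
  "strip_solution q a r s T u \<longleftrightarrow>
     continuous_on ({s..T} \<times> UNIV) (\<lambda>(t, x). u t x) \<and>
     bounded ((\<lambda>(t, x). u t x) ` ({s..T} \<times> UNIV)) \<and>
     (\<exists>u1 u2. \<forall>t\<in>{s<..T}. jet2 (u t) (u1 t) (u2 t) \<and>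
       (\<forall>x. ((\<lambda>\<tau>. u \<tau> x) has_vector_derivative
         (\<Sum>i\<in>UNIV. \<Sum>j\<in>UNIV. (q t x $ i $ j) *\<^sub>R u2 t i j x)
         + (\<Sum>i\<in>UNIV. a i t x *\<^sub>R u1 t i x) + r t x (\<lambda>i. u1 t i x) (u t x)) (at t)))"

lemma strip_solution_diff:
  assumes u: "strip_solution q a r s T u" and v: "strip_solution q a r s T v"
    and r: "\<And>t x P P' w w'. t \<in> {s<..T} \<Longrightarrow> r t x (\<lambda>i. P i - P' i) (w - w') = r t x P w - r t x P' w'"
  shows "strip_solution q a r s T (\<lambda>t x. u t x - v t x)"
proof -
  obtain u1 u2 where u12: "\<And>t. t \<in> {s<..T} \<Longrightarrow> jet2 (u t) (u1 t) (u2 t)"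
    "\<And>t x. t \<in> {s<..T} \<Longrightarrow> ((\<lambda>\<tau>. u \<tau> x) has_vector_derivative
         (\<Sum>i\<in>UNIV. \<Sum>j\<in>UNIV. (q t x $ i $ j) *\<^sub>R u2 t i j x)
         + (\<Sum>i\<in>UNIV. a i t x *\<^sub>R u1 t i x) + r t x (\<lambda>i. u1 t i x) (u t x)) (at t)"
    using u unfolding strip_solution_def by blast
  obtain v1 v2 where v12: "\<And>t. t \<in> {s<..T} \<Longrightarrow> jet2 (v t) (v1 t) (v2 t)"
    "\<And>t x. t \<in> {s<..T} \<Longrightarrow> ((\<lambda>\<tau>. v \<tau> x) has_vector_derivative
         (\<Sum>i\<in>UNIV. \<Sum>j\<in>UNIV. (q t x $ i $ j) *\<^sub>R v2 t i j x)
         + (\<Sum>i\<in>UNIV. a i t x *\<^sub>R v1 t i x) + r t x (\<lambda>i. v1 t i x) (v t x)) (at t)"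
    using v unfolding strip_solution_def by blast
  show ?thesis
    unfolding strip_solution_def
  proof (intro conjI)
    show "continuous_on ({s..T} \<times> UNIV) (\<lambda>(t, x). u t x - v t x)"
      using u v unfolding strip_solution_def case_prod_beta' by (intro continuous_on_diff) auto
    show "bounded ((\<lambda>(t, x). u t x - v t x) ` ({s..T} \<times> UNIV))"
      using u v bounded_minus_comp[of "\<lambda>p. u (fst p) (snd p)" "{s..T} \<times> UNIV" "\<lambda>p. v (fst p) (snd p)"]
      unfolding strip_solution_def case_prod_beta' by blast
    show "\<exists>u1 u2. \<forall>t\<in>{s<..T}. jet2 (\<lambda>x. u t x - v t x) (u1 t) (u2 t) \<and>
       (\<forall>x. ((\<lambda>\<tau>. u \<tau> x - v \<tau> x) has_vector_derivative
         (\<Sum>i\<in>UNIV. \<Sum>j\<in>UNIV. (q t x $ i $ j) *\<^sub>R u2 t i j x)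
         + (\<Sum>i\<in>UNIV. a i t x *\<^sub>R u1 t i x) + r t x (\<lambda>i. u1 t i x) (u t x - v t x)) (at t))"
    proof (intro exI ballI conjI allI)
      fix t assume t: "t \<in> {s<..T}"
      show "jet2 (\<lambda>x. u t x - v t x) ((\<lambda>t i x. u1 t i x - v1 t i x) t) ((\<lambda>t i j x. u2 t i j x - v2 t i j x) t)"
        using jet2_diff[OF u12(1)[OF t] v12(1)[OF t]] by simp
      fix x
      show "((\<lambda>\<tau>. u \<tau> x - v \<tau> x) has_vector_derivative
         (\<Sum>i\<in>UNIV. \<Sum>j\<in>UNIV. (q t x $ i $ j) *\<^sub>R (\<lambda>t i j x. u2 t i j x - v2 t i j x) t i j x)
         + (\<Sum>i\<in>UNIV. a i t x *\<^sub>R (\<lambda>t i x. u1 t i x - v1 t i x) t i x)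
         + r t x (\<lambda>i. (\<lambda>t i x. u1 t i x - v1 t i x) t i x) (u t x - v t x)) (at t)"
        using has_vector_derivative_diff[OF u12(2)[OF t, of x] v12(2)[OF t, of x]]
        by (simp add: r[OF t] scaleR_diff_right sum_subtractf algebra_simps)
    qed
  qed
qed

lemma strip_solution_zero:
  assumes "\<And>t x. r t x (\<lambda>_. 0) 0 = 0"
  shows "strip_solution q a r s T (\<lambda>_ _. 0)"
  unfolding strip_solution_def jet2_def
  by (auto simp: assms image_constant_conv case_prod_beta' intro!: exI[of _ "\<lambda>_ _ _. 0"] exI[of _ "\<lambda>_ _ _ _. 0"])

context lyapunov_strip
begin

text \<open>The maximum principle is applied to \<open>z = |u|\<^sup>p - exp (p K (t - s)) v\<close>. That \<open>|u|\<^sup>p\<close> may fail to be twice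
  differentiable at the zeros of \<open>u\<close> does no harm: since \<open>v \<ge> 0\<close>, the vector \<open>u\<close> is nonzero wherever \<open>z > 0\<close>.
  Computing \<open>D\<^sub>t |u|\<^sup>p - A |u|\<^sup>p\<close> there yields \<open>p |u|\<^bsup>p-2\<^esup>\<close> times the left-hand side of \<open>diss\<close> for \<open>w = u\<close> and \<open>P = Du\<close>, and
  \<open>diss\<close> bounds this by \<open>p K |u|\<^sup>p\<close>.\<close>

lemma norm_powr_le_scalar_solution:
  fixes u :: "real \<Rightarrow> real^'d \<Rightarrow> 'b::real_inner"
  assumes u: "strip_solution q a r s T u"
    and v: "strip_solution q a (\<lambda>_ _ _ _. 0) s T v"
    and v_nonneg: "\<And>t x. t \<in> {s..T} \<Longrightarrow> 0 \<le> v t x"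
    and init: "\<And>x. norm (u s x) powr p \<le> v s x"
    and p: "p > 0"
    and diss: "\<And>t x P w. t \<in> {s<..T} \<Longrightarrow> w \<noteq> 0 \<Longrightarrow>
      w \<bullet> r t x P w
        - (\<Sum>i\<in>UNIV. \<Sum>j\<in>UNIV. q t x $ i $ j * (P i \<bullet> P j))
        - (p - 2) / (w \<bullet> w) * (\<Sum>i\<in>UNIV. \<Sum>j\<in>UNIV. q t x $ i $ j * ((w \<bullet> P i) * (w \<bullet> P j)))
      \<le> K * (w \<bullet> w)"
    and t: "t \<in> {s..T}"
  shows "norm (u t x) powr p \<le> exp (p * K * (t - s)) * v t x"
proof -
  obtain u1 u2 where u12: "\<And>t. t \<in> {s<..T} \<Longrightarrow> jet2 (u t) (u1 t) (u2 t)"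
    "\<And>t x. t \<in> {s<..T} \<Longrightarrow> ((\<lambda>\<tau>. u \<tau> x) has_vector_derivative
         (\<Sum>i\<in>UNIV. \<Sum>j\<in>UNIV. (q t x $ i $ j) *\<^sub>R u2 t i j x)
         + (\<Sum>i\<in>UNIV. a i t x *\<^sub>R u1 t i x) + r t x (\<lambda>i. u1 t i x) (u t x)) (at t)"
    using u unfolding strip_solution_def by blast
  obtain v1 v2 where v12: "\<And>t. t \<in> {s<..T} \<Longrightarrow> jet2 (v t) (v1 t) (v2 t)"
    "\<And>t x. t \<in> {s<..T} \<Longrightarrow> ((\<lambda>\<tau>. v \<tau> x) has_vector_derivative
         (\<Sum>i\<in>UNIV. \<Sum>j\<in>UNIV. (q t x $ i $ j) *\<^sub>R v2 t i j x)
         + (\<Sum>i\<in>UNIV. a i t x *\<^sub>R v1 t i x) + 0) (at t)"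
    using v unfolding strip_solution_def by blast
  define z where "z t x = norm (u t x) powr p - exp (p * K * (t - s)) * v t x" for t x
  obtain b where b: "\<And>t x. t \<in> {s..T} \<Longrightarrow> norm (u t x) \<le> b"
    using u unfolding strip_solution_def bounded_iff by fastforce
  have "z t x \<le> 0"
  proof (rule maximum_principle[OF _ _ _ _ t])
    have cu: "continuous_on ({s..T} \<times> UNIV) (\<lambda>p. u (fst p) (snd p))"
      and cv: "continuous_on ({s..T} \<times> UNIV) (\<lambda>p. v (fst p) (snd p))"
      using u v by (auto simp: strip_solution_def case_prod_beta')
    show "continuous_on ({s..T} \<times> UNIV) (\<lambda>(t, x). z t x)"
      unfolding z_def case_prod_beta'
      using p by (intro continuous_intros continuous_on_powr' cu cv) auto
    show "z t x \<le> b powr p" if "t \<in> {s..T}" for t x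
    proof -
      have "norm (u t x) powr p \<le> b powr p" using b[OF that] p by (intro powr_mono2) auto
      moreover have "exp (p * K * (t - s)) * v t x \<ge> 0" using v_nonneg[OF that] by simp
      ultimately show ?thesis unfolding z_def by linarith
    qed
    show "z s x \<le> 0" for x using init by (simp add: z_def)
    fix t x assume t: "t \<in> {s<..T}" and pos: "z t x > 0"
    define E where "E = exp (p * K * (t - s))"
    define w where "w = u t x"
    define P where "P i = u1 t i x" for i
    define c where "c = p * (w \<bullet> w) powr (p / 2 - 1)"
    define ut where "ut = (\<Sum>i\<in>UNIV. \<Sum>j\<in>UNIV. (q t x $ i $ j) *\<^sub>R u2 t i j x)
         + (\<Sum>i\<in>UNIV. a i t x *\<^sub>R P i) + r t x P w"
    define vt where "vt = (\<Sum>i\<in>UNIV. \<Sum>j\<in>UNIV. (q t x $ i $ j) * v2 t i j x)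
         + (\<Sum>i\<in>UNIV. a i t x * v1 t i x)"
    have "E * v t x \<ge> 0" using v_nonneg[of t x] t by (simp add: E_def)
    then have w0: "w \<noteq> 0" using pos p by (auto simp: z_def E_def[symmetric] w_def)
    then have ww: "w \<bullet> w > 0" by simp
    have c: "c > 0" using p ww by (simp add: c_def)
    have du: "((\<lambda>\<tau>. u \<tau> x) has_vector_derivative ut) (at t)"
      using u12(2)[OF t, of x] by (simp add: ut_def P_def[abs_def] w_def)
    have dv: "((\<lambda>\<tau>. v \<tau> x) has_real_derivative vt) (at t)"
      using v12(2)[OF t, of x] by (simp add: vt_def has_real_derivative_iff_has_vector_derivative)
    have 1: "((\<lambda>\<tau>. z \<tau> x) has_real_derivative c * (w \<bullet> ut) - (E * vt + p * K * E * v t x)) (at t)"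
    proof -
      have "((\<lambda>\<tau>. norm (u \<tau> x) powr p) has_real_derivative c * (w \<bullet> ut)) (at t)"
        unfolding norm_powr_eq_inner_powr
        using has_real_derivative_inner_powr[OF du, of "p / 2"] w0
        by (simp add: w_def c_def mult_ac)
      moreover have "((\<lambda>\<tau>. exp (p * K * (\<tau> - s)) * v \<tau> x) has_real_derivative
          E * vt + p * K * E * v t x) (at t)"
        using dv by (auto intro!: derivative_eq_intros simp: E_def algebra_simps)
      ultimately show ?thesis unfolding z_def by (rule DERIV_diff)
    qed
    have 2: "line_jet (z t) x
        (\<lambda>i. 1 * (c * (w \<bullet> P i)) - E * v1 t i x)
        (\<lambda>i j. 1 * (c * ((p - 2) / (w \<bullet> w) * ((w \<bullet> P i) * (w \<bullet> P j)) + P i \<bullet> P j + w \<bullet> u2 t i j x))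
           - E * v2 t i j x)"
      using line_jet_linear_combination[OF norm_powr_line_jet[OF u12(1)[OF t], of x p]
          jet2_line_jet[OF v12(1)[OF t], of x], of 1 E 0] w0
      by (simp add: z_def[abs_def] E_def w_def P_def c_def)
    define A where "A = (\<Sum>i\<in>UNIV. \<Sum>j\<in>UNIV. q t x $ i $ j * (P i \<bullet> P j))"
    define A' where "A' = (\<Sum>i\<in>UNIV. \<Sum>j\<in>UNIV. q t x $ i $ j * ((w \<bullet> P i) * (w \<bullet> P j)))"
    define W where "W = (\<Sum>i\<in>UNIV. \<Sum>j\<in>UNIV. q t x $ i $ j * (w \<bullet> u2 t i j x))"
    define V where "V = (\<Sum>i\<in>UNIV. \<Sum>j\<in>UNIV. q t x $ i $ j * v2 t i j x)"
    define W' where "W' = (\<Sum>i\<in>UNIV. a i t x * (w \<bullet> P i))"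
    define V' where "V' = (\<Sum>i\<in>UNIV. a i t x * v1 t i x)"
    have "(\<Sum>i\<in>UNIV. \<Sum>j\<in>UNIV. q t x $ i $ j *
        (1 * (c * ((p - 2) / (w \<bullet> w) * ((w \<bullet> P i) * (w \<bullet> P j)) + P i \<bullet> P j + w \<bullet> u2 t i j x))
           - E * v2 t i j x))
      = (\<Sum>i\<in>UNIV. \<Sum>j\<in>UNIV. c * ((p - 2) / (w \<bullet> w)) * (q t x $ i $ j * ((w \<bullet> P i) * (w \<bullet> P j)))
          + c * (q t x $ i $ j * (P i \<bullet> P j)) + c * (q t x $ i $ j * (w \<bullet> u2 t i j x))
          - E * (q t x $ i $ j * v2 t i j x))"
      by (intro sum.cong refl) (simp add: algebra_simps)
    also have "\<dots> = c * ((p - 2) / (w \<bullet> w)) * A' + c * A + c * W - E * V"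
      by (simp only: sum.distrib sum_subtractf sum_distrib_left[symmetric] A_def A'_def W_def V_def)
    finally have qH: "(\<Sum>i\<in>UNIV. \<Sum>j\<in>UNIV. q t x $ i $ j *
        (1 * (c * ((p - 2) / (w \<bullet> w) * ((w \<bullet> P i) * (w \<bullet> P j)) + P i \<bullet> P j + w \<bullet> u2 t i j x))
           - E * v2 t i j x)) = c * ((p - 2) / (w \<bullet> w)) * A' + c * A + c * W - E * V" .
    have ag: "(\<Sum>i\<in>UNIV. a i t x * (1 * (c * (w \<bullet> P i)) - E * v1 t i x)) = c * W' - E * V'"
      by (simp add: W'_def V'_def sum_distrib_left sum_subtractf[symmetric] algebra_simps)
    have wut: "w \<bullet> ut = W + W' + w \<bullet> r t x P w"
      by (simp add: ut_def W_def W'_def inner_add_right inner_sum_right)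
    have vt: "vt = V + V'" by (simp add: vt_def V_def V'_def)
    have "c * (w \<bullet> r t x P w - A - (p - 2) / (w \<bullet> w) * A') \<le> c * (K * (w \<bullet> w))"
      using diss[OF t w0, of x P] c unfolding A_def A'_def by (intro mult_left_mono) auto
    also have "\<dots> = p * K * norm w powr p"
    proof -
      have "(w \<bullet> w) powr (p / 2 - 1) * (w \<bullet> w) = (w \<bullet> w) powr (p / 2)"
        using ww by (simp add: powr_diff)
      then show ?thesis by (simp add: c_def norm_powr_eq_inner_powr mult_ac)
    qed
    finally have ineq: "c * (w \<bullet> r t x P w - A - (p - 2) / (w \<bullet> w) * A') \<le> p * K * norm w powr p" .
    have 3: "c * (w \<bullet> ut) - (E * vt + p * K * E * v t x)
      \<le> (c * ((p - 2) / (w \<bullet> w)) * A' + c * A + c * W - E * V) + (c * W' - E * V') + p * K * z t x"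
      using ineq unfolding wut vt z_def E_def[symmetric] w_def[symmetric] by (simp add: algebra_simps)
    show "\<exists>D g H. ((\<lambda>\<tau>. z \<tau> x) has_real_derivative D) (at t) \<and> line_jet (z t) x g H \<and>
        D \<le> (\<Sum>i\<in>UNIV. \<Sum>j\<in>UNIV. q t x $ i $ j * H i j) + (\<Sum>i\<in>UNIV. a i t x * g i) + p * K * z t x"
      by (intro exI conjI, rule 1, rule 2, unfold qH ag, rule 3)
  qed
  then show ?thesis by (simp add: z_def)
qed

lemma scalar_solution_mono:
  assumes u: "strip_solution q a (\<lambda>_ _ _ _. 0) s T u"
    and v: "strip_solution q a (\<lambda>_ _ _ _. 0) s T (v :: real \<Rightarrow> real^'d \<Rightarrow> real)"
    and init: "\<And>x. u s x \<le> v s x" and t: "t \<in> {s..T}"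
  shows "u t x \<le> v t x"
proof -
  have w: "strip_solution q a (\<lambda>_ _ _ _. 0) s T (\<lambda>t x. u t x - v t x)"
    by (rule strip_solution_diff[OF u v]) simp
  then obtain w1 w2 where w12: "\<And>t. t \<in> {s<..T} \<Longrightarrow> jet2 (\<lambda>x. u t x - v t x) (w1 t) (w2 t)"
    "\<And>t x. t \<in> {s<..T} \<Longrightarrow> ((\<lambda>\<tau>. u \<tau> x - v \<tau> x) has_vector_derivative
         (\<Sum>i\<in>UNIV. \<Sum>j\<in>UNIV. (q t x $ i $ j) *\<^sub>R w2 t i j x)
         + (\<Sum>i\<in>UNIV. a i t x *\<^sub>R w1 t i x) + 0) (at t)"
    unfolding strip_solution_def by blast
  obtain b where b: "\<And>t x. t \<in> {s..T} \<Longrightarrow> norm (u t x - v t x) \<le> b"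
    using w unfolding strip_solution_def bounded_iff by fastforce
  have "u t x - v t x \<le> 0"
  proof (rule maximum_principle[OF _ _ _ _ t, where c = 0])
    show "continuous_on ({s..T} \<times> UNIV) (\<lambda>(t, x). u t x - v t x)"
      using w by (simp add: strip_solution_def)
    show "u t x - v t x \<le> b" if "t \<in> {s..T}" for t x using b[OF that, of x] by simp
    show "u s x - v s x \<le> 0" for x using init by simp
    fix t x assume t: "t \<in> {s<..T}"
    show "\<exists>D g H. ((\<lambda>\<tau>. u \<tau> x - v \<tau> x) has_real_derivative D) (at t) \<and>
        line_jet (\<lambda>x. u t x - v t x) x g H \<and>
        D \<le> (\<Sum>i\<in>UNIV. \<Sum>j\<in>UNIV. q t x $ i $ j * H i j) + (\<Sum>i\<in>UNIV. a i t x * g i) + 0 * (u t x - v t x)"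
      using w12(2)[OF t, of x] jet2_line_jet[OF w12(1)[OF t], of x]
      unfolding has_real_derivative_iff_has_vector_derivative[symmetric] by fastforce
  qed
  then show ?thesis by simp
qed

end

section \<open>Nondivergence form and the evolution operators\<close>

lemma partial_deriv_scaleR:
  fixes g :: "real^'d::finite \<Rightarrow> real" and f :: "real^'d \<Rightarrow> 'b::real_normed_vector"
  assumes "has_partials g" "has_partials f"
  shows "partial_deriv i (\<lambda>y. g y *\<^sub>R f y) x = g x *\<^sub>R partial_deriv i f x + partial_deriv i g x *\<^sub>R f x"
proof -
  have "((\<lambda>h. g (x + h *\<^sub>R axis i 1)) has_vector_derivative partial_deriv i g x) (at 0)"
    "((\<lambda>h. f (x + h *\<^sub>R axis i 1)) has_vector_derivative partial_deriv i f x) (at 0)"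
    using assms unfolding partial_deriv_def has_partials_def
    by (auto simp flip: vector_derivative_works)
  from has_vector_derivative_scaleR[OF this(1)[folded has_real_derivative_iff_has_vector_derivative] this(2)]
  show ?thesis unfolding partial_deriv_def[of i "\<lambda>y. g y *\<^sub>R f y"]
    by (intro vector_derivative_at) simp
qed

text \<open>The first-order coefficients that appear when the divergence in \<open>div (q D) + \<langle>b, D\<rangle>\<close> is expanded.\<close>

definition drift ::
    "(real \<Rightarrow> real^'d \<Rightarrow> real^'d^'d::finite) \<Rightarrow> ('d \<Rightarrow> real \<Rightarrow> real^'d \<Rightarrow> real) \<Rightarrow> 'd \<Rightarrow> real \<Rightarrow> real^'d \<Rightarrow> real" where
  "drift q b i t x = b i t x + (\<Sum>j\<in>UNIV. partial_deriv j (\<lambda>y. q t y $ j $ i) x)"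

lemma div_part_nondivergence:
  assumes q: "\<And>i j. has_partials (\<lambda>y. q t y $ i $ j)" "transpose (q t x) = q t x"
    and f: "C2_fun f"
  shows "div_part q t f x + (\<Sum>i\<in>UNIV. b i t x *\<^sub>R partial_deriv i f x)
    = (\<Sum>i\<in>UNIV. \<Sum>j\<in>UNIV. (q t x $ i $ j) *\<^sub>R partial_deriv j (partial_deriv i f) x)
      + (\<Sum>i\<in>UNIV. drift q b i t x *\<^sub>R partial_deriv i f x)"
proof -
  have sym: "q t x $ i $ j = q t x $ j $ i" for i j
    using q(2) by (simp add: transpose_def vec_eq_iff)
  have "div_part q t f x = (\<Sum>i\<in>UNIV. \<Sum>j\<in>UNIV. (q t x $ i $ j) *\<^sub>R partial_deriv i (partial_deriv j f) x)
      + (\<Sum>i\<in>UNIV. \<Sum>j\<in>UNIV. partial_deriv i (\<lambda>y. q t y $ i $ j) x *\<^sub>R partial_deriv j f x)"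
    using f unfolding div_part_def by (simp add: partial_deriv_scaleR[OF q(1)] C2_fun_def sum.distrib)
  also have "(\<Sum>i\<in>UNIV. \<Sum>j\<in>UNIV. (q t x $ i $ j) *\<^sub>R partial_deriv i (partial_deriv j f) x)
      = (\<Sum>i\<in>UNIV. \<Sum>j\<in>UNIV. (q t x $ i $ j) *\<^sub>R partial_deriv j (partial_deriv i f) x)"
    by (subst sum.swap) (simp only: sym)
  also have "(\<Sum>i\<in>UNIV. \<Sum>j\<in>UNIV. partial_deriv i (\<lambda>y. q t y $ i $ j) x *\<^sub>R partial_deriv j f x)
      = (\<Sum>i\<in>UNIV. (\<Sum>j\<in>UNIV. partial_deriv j (\<lambda>y. q t y $ j $ i) x) *\<^sub>R partial_deriv i f x)"
    by (subst sum.swap) (simp add: scaleR_sum_left)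
  finally show ?thesis by (simp add: drift_def scaleR_add_left sum.distrib)
qed

lemma C12_on_slice:
  assumes "C12_on S u" "t \<in> S"
  shows "C2_fun (u t)"
proof -
  have slice: "continuous_on UNIV (F t)" if "continuous_on (S \<times> UNIV) (\<lambda>(t, x). F t x)"
    for F :: "real \<Rightarrow> real^'a \<Rightarrow> 'b"
  proof -
    have "continuous_on UNIV (\<lambda>x::real^'a. (t, x))" by (intro continuous_intros)
    from continuous_on_compose2[OF that this] show ?thesis using assms(2) by auto
  qed
  show ?thesis
    using assms unfolding C12_on_def C2_fun_def
    by (auto intro: slice[of u] slice[of "\<lambda>t. partial_deriv i (u t)" for i]
        slice[of "\<lambda>t. partial_deriv j (partial_deriv i (u t))" for i j])
qed

lemma classical_solution_strip_solution:
  assumes u: "classical_solution L s f u" "strip_bounded s u" and "s < T"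
    and L: "\<And>t x g. t \<in> {s<..T} \<Longrightarrow> C2_fun g \<Longrightarrow> L t g x =
      (\<Sum>i\<in>UNIV. \<Sum>j\<in>UNIV. (q t x $ i $ j) *\<^sub>R partial_deriv j (partial_deriv i g) x)
      + (\<Sum>i\<in>UNIV. a i t x *\<^sub>R partial_deriv i g x) + r t x (\<lambda>i. partial_deriv i g x) (g x)"
  shows "strip_solution q a r s T u"
  unfolding strip_solution_def
proof (intro conjI)
  have C12: "C12_on {s<..} u" using u(1) by (simp add: classical_solution_def)
  show "continuous_on ({s..T} \<times> UNIV) (\<lambda>(t, x). u t x)"
    using u(1) unfolding classical_solution_def by (auto intro: continuous_on_subset)
  show "bounded ((\<lambda>(t, x). u t x) ` ({s..T} \<times> UNIV))"
    using u(2) \<open>s < T\<close> by (simp add: strip_bounded_def)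
  show "\<exists>u1 u2. \<forall>t\<in>{s<..T}. jet2 (u t) (u1 t) (u2 t) \<and>
       (\<forall>x. ((\<lambda>\<tau>. u \<tau> x) has_vector_derivative
         (\<Sum>i\<in>UNIV. \<Sum>j\<in>UNIV. (q t x $ i $ j) *\<^sub>R u2 t i j x)
         + (\<Sum>i\<in>UNIV. a i t x *\<^sub>R u1 t i x) + r t x (\<lambda>i. u1 t i x) (u t x)) (at t))"
  proof (intro exI ballI conjI allI)
    fix t assume t: "t \<in> {s<..T}"
    have C2: "C2_fun (u t)" using C12 t by (intro C12_on_slice) auto
    show "jet2 (u t) ((\<lambda>t i. partial_deriv i (u t)) t) ((\<lambda>t i j. partial_deriv j (partial_deriv i (u t))) t)"
      using C2_fun_jet2[OF C2] by simp
    fix x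
    have "((\<lambda>\<tau>. u \<tau> x) has_vector_derivative L t (u t) x) (at t)"
      using u(1) C12 t unfolding classical_solution_def C12_on_def
      by (metis greaterThanAtMost_iff greaterThan_iff vector_derivative_works)
    then show "((\<lambda>\<tau>. u \<tau> x) has_vector_derivative
         (\<Sum>i\<in>UNIV. \<Sum>j\<in>UNIV. (q t x $ i $ j) *\<^sub>R (\<lambda>t i j. partial_deriv j (partial_deriv i (u t))) t i j x)
         + (\<Sum>i\<in>UNIV. a i t x *\<^sub>R (\<lambda>t i. partial_deriv i (u t)) t i x)
         + r t x (\<lambda>i. (\<lambda>t i. partial_deriv i (u t)) t i x) (u t x)) (at t)"
      by (simp only: L[OF t C2])
  qed
qed

text \<open>Uniqueness is required only at the time \<open>t\<close> under consideration, which is what a comparison on the strip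
  \<open>[s, t]\<close> provides.\<close>

lemma evol_op_eq:
  assumes "classical_solution L s f u" "strip_bounded s u"
    and "\<And>v. classical_solution L s f v \<Longrightarrow> strip_bounded s v \<Longrightarrow> v t = u t"
  shows "evol_op L t s f = u t"
  unfolding evol_op_def
proof (rule the_equality)
  show "\<exists>v. classical_solution L s f v \<and> strip_bounded s v \<and> u t = v t" using assms(1,2) by blast
  show "g = u t" if "\<exists>v. classical_solution L s f v \<and> strip_bounded s v \<and> g = v t" for g
    using that assms(3) by blast
qed

lemma norm_powr_bcontfun:
  assumes "f \<in> bcontfun" "p > 0"
  shows "(\<lambda>y. norm (f y) powr p) \<in> bcontfun"
proof -
  have f: "continuous_on UNIV f" using assms(1) by (simp add: bcontfun_def)
  obtain c where c: "\<And>y. norm (f y) \<le> c" using assms(1) unfolding bcontfun_def bounded_iff by blast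
  have "norm (norm (f y) powr p) \<le> c powr p" for y
    using c[of y] \<open>p > 0\<close> by (simp add: powr_mono2)
  moreover have "continuous_on UNIV (\<lambda>y. norm (f y) powr p)"
    using \<open>p > 0\<close> by (intro continuous_on_powr' continuous_intros f) auto
  ultimately show ?thesis by (intro bcontfun_normI)
qed

section \<open>The pointwise estimate of the vector-valued evolution operator\<close>

theorem proposition2p8:
  fixes I :: "real set" and \<alpha> \<sigma> :: real
    and q :: "real \<Rightarrow> real^'d \<Rightarrow> real^'d^'d::finite"
    and B Bt :: "'d \<Rightarrow> real \<Rightarrow> real^'d \<Rightarrow> real^'m^'m::finite"
    and C :: "real \<Rightarrow> real^'d \<Rightarrow> real^'m^'m"
    and b :: "'d \<Rightarrow> real \<Rightarrow> real^'d \<Rightarrow> real"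
    and \<xi> :: "real \<Rightarrow> real"
  assumes I: "I = UNIV \<or> (\<exists>a. I = {a<..})"
    and \<alpha>: "0 < \<alpha>" "\<alpha> < 1"
    and sym_q: "\<And>t x. t \<in> I \<Longrightarrow> transpose (q t x) = q t x"
    and sym_B: "\<And>i t x. t \<in> I \<Longrightarrow> transpose (B i t x) = B i t x"
    and sym_C: "\<And>t x. t \<in> I \<Longrightarrow> transpose (C t x) = C t x"
    and reg_q: "\<And>i j. loc_holder1 \<alpha> I (\<lambda>t x. q t x $ i $ j)"
    and reg_B: "\<And>i j k. loc_holder1 \<alpha> I (\<lambda>t x. B i t x $ j $ k)"
    and reg_C: "\<And>j k. loc_holder \<alpha> I (\<lambda>t x. C t x $ j $ k)"
    and ellip_bdd: "bdd_below ((\<lambda>(t, x). min_eigenvalue (q t x)) ` (I \<times> UNIV))"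
    and ellip_pos: "(INF (t, x)\<in>I \<times> UNIV. min_eigenvalue (q t x)) > 0"
    and B_split: "\<And>i t x. t \<in> I \<Longrightarrow> B i t x = b i t x *\<^sub>R mat 1 + Bt i t x"
    and \<sigma>: "\<sigma> > 0"
    and \<xi>: "\<And>t. t \<in> I \<Longrightarrow> \<xi> t > 0"
    and Bt_bound: "\<And>i j k t x. t \<in> I \<Longrightarrow>
          \<bar>Bt i t x $ j $ k\<bar> \<le> \<xi> t * min_eigenvalue (q t x) powr \<sigma>"
    and H_fin: "\<And>J. is_interval J \<Longrightarrow> bounded J \<Longrightarrow> J \<subseteq> I \<Longrightarrow>
          \<exists>\<beta>\<ge>1/4. H_finite q C \<xi> \<sigma> \<beta> J"
    and lyapunov: "\<And>J. is_interval J \<Longrightarrow> bounded J \<Longrightarrow> J \<subseteq> I \<Longrightarrow>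
          \<exists>l>0. \<exists>\<phi>. C2_fun \<phi> \<and> (\<forall>x. \<phi> x > 0) \<and> filterlim \<phi> at_top at_infinity \<and>
            bdd_above ((\<lambda>(t, x). scalar_op q b t \<phi> x - l * \<phi> x) ` (J \<times> UNIV))"
    and solvable_system: "solvable (system_op q B C) I"
    and solvable_scalar: "solvable (scalar_op q b) I"
  shows "\<forall>J \<beta> p. is_interval J \<and> bounded J \<and> J \<subseteq> I \<and> \<beta> \<ge> 1/4 \<and> H_finite q C \<xi> \<sigma> \<beta> J \<and>
           p \<ge> 1 + 1 / (4 * \<beta>) \<longrightarrow>
         (let estimate = (\<lambda>K. \<forall>t\<in>J. \<forall>s\<in>J. \<forall>x. \<forall>f\<in>bcontfun. s < t \<longrightarrow>
                norm (evol_op (system_op q B C) t s f x) powr p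
                \<le> exp (p * K * (t - s)) *
                  evol_op (scalar_op q b) t s (\<lambda>y. norm (f y) powr p) x)
          in (\<exists>K>0. estimate K) \<and>
             estimate (if p \<ge> 2 then H_const q C \<xi> \<sigma> (1/4) J else H_const q C \<xi> \<sigma> \<beta> J))"
proof (intro allI impI)
  fix J \<beta> p
  assume asm: "is_interval J \<and> bounded J \<and> J \<subseteq> I \<and> \<beta> \<ge> 1/4 \<and> H_finite q C \<xi> \<sigma> \<beta> J \<and> p \<ge> 1 + 1 / (4 * \<beta>)"
  then have J: "is_interval J" "bounded J" "J \<subseteq> I" and \<beta>: "\<beta> \<ge> 1/4" "H_finite q C \<xi> \<sigma> \<beta> J"
    and p: "p \<ge> 1 + 1 / (4 * \<beta>)" by auto
  define r where "r = (\<lambda>t x P w. (\<Sum>i\<in>UNIV. Bt i t x *v P i) + C t x *v w)"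
  have "1 / (4 * \<beta>) > 0" using \<beta>(1) by simp
  with p have p1: "p > 1" by linarith

  have q_pos: "min_eigenvalue (q t x) > 0" if "t \<in> I" for t x
    using cINF_lower[OF ellip_bdd, of "(t, x)"] ellip_pos that by force
  have q_psd: "0 \<le> v \<bullet> (q t x *v v)" if "t \<in> I" for t x v
    using quadratic_form_ge_min_eigenvalue[OF sym_q[OF that], of x v] q_pos[OF that, of x]
    by (meson less_imp_le mult_nonneg_nonneg order_trans zero_le_power2)
  have q_partials: "has_partials (\<lambda>x. q t x $ i $ j)" if "t \<in> I" for t i j
    using reg_q that by (auto simp: loc_holder1_def)

  have nondivergence: "div_part q t g x + (\<Sum>i\<in>UNIV. b i t x *\<^sub>R partial_deriv i g x)
      = (\<Sum>i\<in>UNIV. \<Sum>j\<in>UNIV. (q t x $ i $ j) *\<^sub>R partial_deriv j (partial_deriv i g) x)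
        + (\<Sum>i\<in>UNIV. drift q b i t x *\<^sub>R partial_deriv i g x)"
    if "t \<in> I" "C2_fun g" for t x and g :: "real^'d \<Rightarrow> 'c::real_normed_vector"
    using q_partials[OF that(1)] sym_q[OF that(1)] that(2) by (rule div_part_nondivergence)
  have scalar_form: "scalar_op q b t g x =
      (\<Sum>i\<in>UNIV. \<Sum>j\<in>UNIV. (q t x $ i $ j) *\<^sub>R partial_deriv j (partial_deriv i g) x)
      + (\<Sum>i\<in>UNIV. drift q b i t x *\<^sub>R partial_deriv i g x) + 0" if "t \<in> I" "C2_fun g" for t x g
    using nondivergence[OF that, of x] by (simp only: scalar_op_def real_scaleR_def add_0_right)
  have system_form: "system_op q B C t g x =
      (\<Sum>i\<in>UNIV. \<Sum>j\<in>UNIV. (q t x $ i $ j) *\<^sub>R partial_deriv j (partial_deriv i g) x)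
      + (\<Sum>i\<in>UNIV. drift q b i t x *\<^sub>R partial_deriv i g x) + r t x (\<lambda>i. partial_deriv i g x) (g x)"
    if "t \<in> I" "C2_fun g" for t x g
  proof -
    have "B i t x *v y = b i t x *\<^sub>R y + Bt i t x *v y" for i y
      by (simp add: B_split[OF that(1)] matrix_vector_mult_add_rdistrib scaleR_matrix_vector_assoc[symmetric])
    then show ?thesis
      using nondivergence[OF that, of x]
      by (simp only: system_op_def r_def sum.distrib add.assoc[symmetric])
  qed

  have dissipation: "w \<bullet> r t x P w
        - (\<Sum>i\<in>UNIV. \<Sum>j\<in>UNIV. q t x $ i $ j * (P i \<bullet> P j))
        - (p - 2) / (w \<bullet> w) * (\<Sum>i\<in>UNIV. \<Sum>j\<in>UNIV. q t x $ i $ j * ((w \<bullet> P i) * (w \<bullet> P j)))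
      \<le> H_const q C \<xi> \<sigma> \<kappa> J * (w \<bullet> w)"
    if "t \<in> J" "w \<noteq> 0" "\<kappa> \<ge> 1/4" "1 < p" "1 \<le> 4 * \<kappa> * (p - 1)" "H_finite q C \<xi> \<sigma> \<kappa> J"
    for t x P w p \<kappa>
    unfolding r_def
  proof (rule dissipation_inequality[where \<gamma> = "min 1 (p - 1)" and \<kappa> = \<kappa>])
    have t: "t \<in> I" using that J by auto
    show "transpose (q t x) = q t x" "transpose (C t x) = C t x" using sym_q sym_C t by auto
    show "min_eigenvalue (q t x) > 0" by (rule q_pos[OF t])
    show "\<bar>Bt i t x $ j $ k\<bar> \<le> \<xi> t * min_eigenvalue (q t x) powr \<sigma>" for i j k by (rule Bt_bound[OF t])
    show "1 / (4 * min 1 (p - 1)) \<le> \<kappa>" using that by (auto simp: min_def field_simps)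
    have "H_fun q C \<xi> \<sigma> \<kappa> (t, x) \<le> H_const q C \<xi> \<sigma> \<kappa> J"
      using that(1,6) unfolding H_const_def H_finite_def by (intro cSUP_upper) auto
    then show "max_eigenvalue (C t x) + \<kappa> * real CARD('d) * (real CARD('m))\<^sup>2 * (\<xi> t)\<^sup>2
        * min_eigenvalue (q t x) powr (2 * \<sigma> - 1) \<le> H_const q C \<xi> \<sigma> \<kappa> J"
      by (simp add: H_fun_def)
  qed (use that in auto)

  have fin4: "H_finite q C \<xi> \<sigma> (1/4) J"
  proof -
    obtain M where M: "\<And>t x. t \<in> J \<Longrightarrow> H_fun q C \<xi> \<sigma> \<beta> (t, x) \<le> M"
      using \<beta>(2) unfolding H_finite_def bdd_above_def by auto
    have "H_fun q C \<xi> \<sigma> (1/4) (t, x) \<le> H_fun q C \<xi> \<sigma> \<beta> (t, x)" for t x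
      unfolding H_fun_def prod.case using \<beta>(1) by (intro add_left_mono mult_right_mono) auto
    with M have "H_fun q C \<xi> \<sigma> (1/4) (t, x) \<le> M" if "t \<in> J" for t x
      using that by (meson order_trans)
    then show ?thesis unfolding H_finite_def by (intro bdd_aboveI2[where M = M]) auto
  qed

  obtain l \<phi> M where l: "l > 0" and \<phi>: "C2_fun \<phi>" "\<And>x. \<phi> x > 0" "filterlim \<phi> at_top at_infinity"
    and M: "\<And>t x. t \<in> J \<Longrightarrow> scalar_op q b t \<phi> x - l * \<phi> x \<le> M"
  proof -
    obtain l \<phi> where l\<phi>: "l > 0" "C2_fun \<phi>" "\<forall>x. \<phi> x > 0" "filterlim \<phi> at_top at_infinity"
      and "bdd_above ((\<lambda>(t, x). scalar_op q b t \<phi> x - l * \<phi> x) ` (J \<times> UNIV))"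
      using lyapunov[OF J] by blast
    then obtain M where "\<And>t x. t \<in> J \<Longrightarrow> scalar_op q b t \<phi> x - l * \<phi> x \<le> M"
      unfolding bdd_above_def by auto
    with l\<phi> show thesis by (intro that) auto
  qed

  \<comment> \<open>The hypothesis on \<open>p\<close> is equivalent to \<open>1 / (4 (p - 1)) \<le> \<beta>\<close>; for \<open>p \<ge> 2\<close> the value \<open>1/4\<close> always suffices.\<close>
  define \<kappa> where "\<kappa> = (if p \<ge> 2 then 1/4 else \<beta>)"
  define H where "H = H_const q C \<xi> \<sigma> \<kappa> J"
  have \<kappa>: "\<kappa> \<ge> 1/4" "H_finite q C \<xi> \<sigma> \<kappa> J" using \<beta> fin4 by (auto simp: \<kappa>_def)
  have "1 \<le> 4 * \<beta> * (p - 1)" using p \<beta>(1) by (simp add: field_simps)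
  then have \<kappa>p: "1 \<le> 4 * \<kappa> * (p - 1)" by (simp add: \<kappa>_def)

  have core: "0 \<le> evol_op (scalar_op q b) t s (\<lambda>y. norm (f y) powr p) x \<and>
      norm (evol_op (system_op q B C) t s f x) powr p
      \<le> exp (p * H * (t - s)) * evol_op (scalar_op q b) t s (\<lambda>y. norm (f y) powr p) x"
    if t: "t \<in> J" and s: "s \<in> J" and f: "f \<in> bcontfun" and "s < t" for t s x and f :: "real^'d \<Rightarrow> real^'m"
  proof -
    have sub: "{s..t} \<subseteq> J" using mem_is_interval_1_I[OF J(1) s t] by auto
    then have subI: "{s..t} \<subseteq> I" using J(3) by blast
    have tI: "\<tau> \<in> I" if "\<tau> \<in> {s<..t}" for \<tau> using that subI by auto
    have tJ: "\<tau> \<in> J" if "\<tau> \<in> {s<..t}" for \<tau> using that sub by auto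
    interpret lyapunov_strip q "drift q b" s t \<phi> l M
    proof
      show "(\<Sum>i\<in>UNIV. \<Sum>j\<in>UNIV. q \<tau> x $ i $ j * partial_deriv j (partial_deriv i \<phi>) x)
        + (\<Sum>i\<in>UNIV. drift q b i \<tau> x * partial_deriv i \<phi> x) \<le> l * \<phi> x + M" if "\<tau> \<in> {s<..t}" for \<tau> x
        using M[OF tJ[OF that], of x] scalar_form[OF tI[OF that] \<phi>(1), of x] by simp
      show "transpose (q \<tau> x) = q \<tau> x" if "\<tau> \<in> {s..t}" for \<tau> x using that subI sym_q by blast
      show "0 \<le> y \<bullet> (q \<tau> x *v y)" if "\<tau> \<in> {s..t}" for \<tau> x y using that subI q_psd by blast
    qed (fact \<phi> l)+
    have st: "s \<in> {s..t}" "t \<in> {s..t}" using \<open>s < t\<close> by auto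
    have scalar_strip: "strip_solution q (drift q b) (\<lambda>_ _ _ _. 0) s t v"
      if "classical_solution (scalar_op q b) s g v" "strip_bounded s v" for g v
      using that \<open>s < t\<close> scalar_form[OF tI] by (rule classical_solution_strip_solution)
    have system_strip: "strip_solution q (drift q b) r s t u"
      if "classical_solution (system_op q B C) s g u" "strip_bounded s u" for g u
      using that \<open>s < t\<close> system_form[OF tI] by (rule classical_solution_strip_solution)
    have sI: "s \<in> I" using s J(3) by blast
    have fp: "(\<lambda>y. norm (f y) powr p) \<in> bcontfun" using f p1 by (intro norm_powr_bcontfun) auto
    obtain v where v: "classical_solution (scalar_op q b) s (\<lambda>y. norm (f y) powr p) v" "strip_bounded s v"
      using solvable_scalar[unfolded solvable_def, rule_format, OF sI fp] by blast
    obtain u where u: "classical_solution (system_op q B C) s f u" "strip_bounded s u"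
      using solvable_system[unfolded solvable_def, rule_format, OF sI f] by blast
    have init: "u s = f" "v s = (\<lambda>y. norm (f y) powr p)"
      using u(1) v(1) by (auto simp: classical_solution_def)
    have zero: "strip_solution q (drift q b) (\<lambda>_ _ _ _. 0) s t (\<lambda>_ _. 0::real)"
      by (rule strip_solution_zero) simp
    have v_nonneg: "0 \<le> v \<tau> x" if "\<tau> \<in> {s..t}" for \<tau> x
      using scalar_solution_mono[OF zero scalar_strip[OF v] _ that] init by simp
    have v_eq: "evol_op (scalar_op q b) t s (\<lambda>y. norm (f y) powr p) = v t"
    proof (rule evol_op_eq[OF v])
      fix v' assume v': "classical_solution (scalar_op q b) s (\<lambda>y. norm (f y) powr p) v'" "strip_bounded s v'"
      have "v' s = v s" using v'(1) init by (simp add: classical_solution_def)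
      then have "v' t y \<le> v t y" "v t y \<le> v' t y" for y
        by (intro scalar_solution_mono[OF scalar_strip[OF v'] scalar_strip[OF v] _ st(2)]
            scalar_solution_mono[OF scalar_strip[OF v] scalar_strip[OF v'] _ st(2)]; simp)+
      then show "v' t = v t" by (intro ext antisym)
    qed
    \<comment> \<open>The difference of two solutions starts from zero, so the case \<open>p = 2\<close> compares it with \<open>v = 0\<close>.\<close>
    have u_eq: "evol_op (system_op q B C) t s f = u t"
    proof (rule evol_op_eq[OF u], rule ext)
      fix u' x assume u': "classical_solution (system_op q B C) s f u'" "strip_bounded s u'"
      have "strip_solution q (drift q b) r s t (\<lambda>t x. u' t x - u t x)"
        by (rule strip_solution_diff[OF system_strip[OF u'] system_strip[OF u]])
           (simp add: r_def matrix_vector_mult_diff_distrib sum_subtractf)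
      then have "norm (u' t x - u t x) powr 2 \<le> exp (2 * H_const q C \<xi> \<sigma> (1/4) J * (t - s)) * 0"
      proof (rule norm_powr_le_scalar_solution[OF _ zero])
        show "norm (u' s x - u s x) powr 2 \<le> 0" for x
          using u'(1) init by (simp add: classical_solution_def)
        show "w \<bullet> r \<tau> x P w
            - (\<Sum>i\<in>UNIV. \<Sum>j\<in>UNIV. q \<tau> x $ i $ j * (P i \<bullet> P j))
            - (2 - 2) / (w \<bullet> w) * (\<Sum>i\<in>UNIV. \<Sum>j\<in>UNIV. q \<tau> x $ i $ j * ((w \<bullet> P i) * (w \<bullet> P j)))
          \<le> H_const q C \<xi> \<sigma> (1/4) J * (w \<bullet> w)" if "\<tau> \<in> {s<..t}" "w \<noteq> 0" for \<tau> x P w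
          by (rule dissipation[OF tJ[OF that(1)] that(2) _ _ _ fin4]) simp_all
      qed (use st in simp_all)
      then show "u' t x = u t x" by simp
    qed
    have "norm (u t x) powr p \<le> exp (p * H * (t - s)) * v t x"
      unfolding H_def
    proof (rule norm_powr_le_scalar_solution[OF system_strip[OF u] scalar_strip[OF v] v_nonneg _ _ _ st(2)])
      show "w \<bullet> r \<tau> x P w
          - (\<Sum>i\<in>UNIV. \<Sum>j\<in>UNIV. q \<tau> x $ i $ j * (P i \<bullet> P j))
          - (p - 2) / (w \<bullet> w) * (\<Sum>i\<in>UNIV. \<Sum>j\<in>UNIV. q \<tau> x $ i $ j * ((w \<bullet> P i) * (w \<bullet> P j)))
        \<le> H_const q C \<xi> \<sigma> \<kappa> J * (w \<bullet> w)" if "\<tau> \<in> {s<..t}" "w \<noteq> 0" for \<tau> x P w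
        by (rule dissipation[OF tJ[OF that(1)] that(2) \<kappa>(1) p1 \<kappa>p \<kappa>(2)])
    qed (use p1 init in simp_all)
    with v_nonneg[OF st(2)] show ?thesis unfolding u_eq v_eq by blast
  qed
  have H_eq: "(if p \<ge> 2 then H_const q C \<xi> \<sigma> (1/4) J else H_const q C \<xi> \<sigma> \<beta> J) = H"
    by (simp add: H_def \<kappa>_def)
  show "let estimate = (\<lambda>K. \<forall>t\<in>J. \<forall>s\<in>J. \<forall>x. \<forall>f\<in>bcontfun. s < t \<longrightarrow>
                norm (evol_op (system_op q B C) t s f x) powr p
                \<le> exp (p * K * (t - s)) *
                  evol_op (scalar_op q b) t s (\<lambda>y. norm (f y) powr p) x)
          in (\<exists>K>0. estimate K) \<and>
             estimate (if p \<ge> 2 then H_const q C \<xi> \<sigma> (1/4) J else H_const q C \<xi> \<sigma> \<beta> J)"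
    unfolding Let_def H_eq
  proof (intro conjI)
    \<comment> \<open>\<open>H\<close> may be negative, but the scalar evolution is nonnegative, so any larger constant serves as well.\<close>
    show "\<exists>K>0. \<forall>t\<in>J. \<forall>s\<in>J. \<forall>x. \<forall>f\<in>bcontfun. s < t \<longrightarrow>
        norm (evol_op (system_op q B C) t s f x) powr p
        \<le> exp (p * K * (t - s)) * evol_op (scalar_op q b) t s (\<lambda>y. norm (f y) powr p) x"
    proof (intro exI[of _ "max H 1"] conjI ballI allI impI)
      fix t s x and f :: "real^'d \<Rightarrow> real^'m"
      assume "t \<in> J" "s \<in> J" "f \<in> bcontfun" "s < t"
      note c = core[OF this, of x]
      have "exp (p * H * (t - s)) \<le> exp (p * max H 1 * (t - s))"
        using p1 \<open>s < t\<close> by (simp add: mult_right_mono)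
      with c show "norm (evol_op (system_op q B C) t s f x) powr p
          \<le> exp (p * max H 1 * (t - s)) * evol_op (scalar_op q b) t s (\<lambda>y. norm (f y) powr p) x"
        by (meson mult_right_mono order_trans)
    qed simp
  qed (use core in blast)
qed

end
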